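(* Let $X,Y$ be Banach spaces. Suppose that $\operatorname{SE}(X)$ is dense in $X^*$ and that $Y$ has property quasi-$\beta$. Then, for every closed subspace $\mathcal{I}(X,Y)$ of $\mathcal{L}(X,Y)$ containing all rank one operators, $\operatorname{ASE}(X,Y)\cap\mathcal{I}(X,Y)$ is dense in $\mathcal{I}(X,Y)$. In particular, $\operatorname{ASE}(X,Y)$ is dense in $\mathcal{L}(X,Y)$ and $\operatorname{ASE}(X,Y)\cap\mathcal{K}(X,Y)$ is dense in $\mathcal{K}(X,Y)$.
   Context: $\mathbb{K}\in\{\mathbb{R},\mathbb{C}\}$, $\mathbb{T}=\{\lambda\in\mathbb{K}\colon|\lambda|=1\}$. $\mathcal{K}(X,Y)$ is the space of compact operators. $\operatorname{SE}(X)$ is the set of $x^*\in X^*$ strongly exposing $B_X$ (there is $x_0\in B_X$ with $\operatorname{Re}x^*(x_0)=\sup_{B_X}\operatorname{Re}x^*$ and every sequence in $B_X$ with $\operatorname{Re}x^*(x_n)\to\operatorname{Re}x^*(x_0)$ converges in norm to $x_0$). $\operatorname{ASE}(X,Y)$ is the set of $T\in\mathcal{L}(X,Y)$ for which there is $x_0\in B_X$ such that whenever $\{x_n\}\subset B_X$ and $\|Tx_n\|\to\|T\|$, there exist $\theta_n\in\mathbb{T}$ with $\theta_nx_n\to x_0$. $Y$ has property quasi-$\beta$ if there exist a set $A=\{y_\lambda^*\colon\lambda\in\Lambda\}\subset S_{Y^*}$, a map $\sigma\colon A\to S_Y$ and a function $\rho\colon A\to\mathbb{R}$ such that (i) $y^*_\lambda(\sigma(y^*_\lambda))=1$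 for all $\lambda$; (ii) $|z^*(\sigma(y^* ))|\le\rho(y^* )<1$ whenever $y^*,z^*\in A$, $y^*\ne z^*$; (iii) for every extreme point $e^*$ of $B_{Y^*}$ there exist $A_{e^*}\subset A$ and $t\in\mathbb{K}$ with $|t|=1$ such that $te^*$ belongs to the weak$^*$-closure of $A_{e^*}$ and $\sup\{\rho(y^* )\colon y^*\in A_{e^*}\}<1$. *)

theory Defs
  imports "HOL-Analysis.Analysis"
begin

text \<open>Scalars: a real normed field 'k (instantiated with real or complex).
 A Banach space over 'k is modelled as a real Banach space 'x (type class banach)
 together with a 'k-scalar multiplication sc compatible with the real structure
 and the norm.\<close>

definition kbanach :: "('k::real_normed_field \<Rightarrow> 'x::banach \<Rightarrow> 'x) \<Rightarrow> bool" where
  "kbanach sc \<longleftrightarrow>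
     (\<forall>a x y. sc a (x + y) = sc a x + sc a y) \<and>
     (\<forall>a b x. sc (a + b) x = sc a x + sc b x) \<and>
     (\<forall>a b x. sc a (sc b x) = sc (a * b) x) \<and>
     (\<forall>x. sc 1 x = x) \<and>
     (\<forall>r x. sc (of_real r) x = scaleR r x) \<and>
     (\<forall>a x. norm (sc a x) = norm a * norm x)"

definition Lop :: "('k::real_normed_field \<Rightarrow> 'x::banach \<Rightarrow> 'x) \<Rightarrow> ('k \<Rightarrow> 'y::banach \<Rightarrow> 'y)
     \<Rightarrow> ('x \<Rightarrow>\<^sub>L 'y) set" where
  "Lop sX sY = {T. \<forall>a x. blinfun_apply T (sX a x) = sY a (blinfun_apply T x)}"

definition Dual :: "('k::real_normed_field \<Rightarrow> 'x::banach \<Rightarrow> 'x) \<Rightarrow> ('x \<Rightarrow>\<^sub>L 'k) set" where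
  "Dual sX = {f. \<forall>a x. blinfun_apply f (sX a x) = a * blinfun_apply f x}"

definition Kop :: "('k::real_normed_field \<Rightarrow> 'x::banach \<Rightarrow> 'x) \<Rightarrow> ('k \<Rightarrow> 'y::banach \<Rightarrow> 'y)
     \<Rightarrow> ('x \<Rightarrow>\<^sub>L 'y) set" where
  "Kop sX sY = {T \<in> Lop sX sY. compact (closure (blinfun_apply T ` cball 0 1))}"

text \<open>SE(X); re is the real-part map of the scalar field (id for real, Re for complex).\<close>
definition SE :: "('k::real_normed_field \<Rightarrow> real) \<Rightarrow> ('k \<Rightarrow> 'x::banach \<Rightarrow> 'x) \<Rightarrow> ('x \<Rightarrow>\<^sub>L 'k) set" where
  "SE re sX = {f \<in> Dual sX. \<exists>x0 \<in> cball 0 1.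
      re (blinfun_apply f x0) = (SUP x \<in> cball 0 1. re (blinfun_apply f x)) \<and>
      (\<forall>xs. (\<forall>n. xs n \<in> cball 0 1) \<and> (\<lambda>n. re (blinfun_apply f (xs n))) \<longlonglongrightarrow> re (blinfun_apply f x0)
            \<longrightarrow> xs \<longlonglongrightarrow> x0)}"

definition ASE :: "('k::real_normed_field \<Rightarrow> 'x::banach \<Rightarrow> 'x) \<Rightarrow> ('k \<Rightarrow> 'y::banach \<Rightarrow> 'y)
     \<Rightarrow> ('x \<Rightarrow>\<^sub>L 'y) set" where
  "ASE sX sY = {T \<in> Lop sX sY. \<exists>x0 \<in> cball 0 1.
      \<forall>xs. (\<forall>n. xs n \<in> cball 0 1) \<and> (\<lambda>n. norm (blinfun_apply T (xs n))) \<longlonglongrightarrow> norm T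
        \<longrightarrow> (\<exists>\<theta>. (\<forall>n. norm (\<theta> n) = 1) \<and> (\<lambda>n. sX (\<theta> n) (xs n)) \<longlonglongrightarrow> x0)}"

text \<open>Property quasi-beta. The weak-star closure of a set of functionals is the
 closure in the product (pointwise) topology on functions 'y => 'k.
 Extreme points are those of the closed unit ball of Y^*.\<close>
definition quasi_beta :: "('k::real_normed_field \<Rightarrow> 'y::banach \<Rightarrow> 'y) \<Rightarrow> bool" where
  "quasi_beta sY \<longleftrightarrow> (\<exists>(A :: ('y \<Rightarrow>\<^sub>L 'k) set) (\<sigma> :: ('y \<Rightarrow>\<^sub>L 'k) \<Rightarrow> 'y) (\<rho> :: ('y \<Rightarrow>\<^sub>L 'k) \<Rightarrow> real).
     A \<subseteq> Dual sY \<inter> sphere 0 1 \<and>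
     (\<forall>g \<in> A. \<sigma> g \<in> sphere 0 1) \<and>
     (\<forall>g \<in> A. blinfun_apply g (\<sigma> g) = 1) \<and>
     (\<forall>g \<in> A. \<forall>h \<in> A. g \<noteq> h \<longrightarrow> norm (blinfun_apply h (\<sigma> g)) \<le> \<rho> g \<and> \<rho> g < 1) \<and>
     (\<forall>e. e extreme_point_of (Dual sY \<inter> cball 0 1) \<longrightarrow>
        (\<exists>Ae \<subseteq> A. \<exists>t::'k. norm t = 1 \<and>
           (\<lambda>y. t * blinfun_apply e y) \<in> closure (blinfun_apply ` Ae) \<and>
           (\<exists>r < 1. \<forall>g \<in> Ae. \<rho> g \<le> r))))"

definition closed_subspace_rank1 :: "('k::real_normed_field \<Rightarrow> 'x::banach \<Rightarrow> 'x) \<Rightarrow> ('k \<Rightarrow> 'y::banach \<Rightarrow> 'y)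
     \<Rightarrow> ('x \<Rightarrow>\<^sub>L 'y) set \<Rightarrow> bool" where
  "closed_subspace_rank1 sX sY I \<longleftrightarrow>
     I \<subseteq> Lop sX sY \<and> closed I \<and> 0 \<in> I \<and>
     (\<forall>S \<in> I. \<forall>T \<in> I. S + T \<in> I) \<and>
     (\<forall>a. \<forall>T \<in> I. \<forall>S \<in> Lop sX sY. (\<forall>x. blinfun_apply S x = sY a (blinfun_apply T x)) \<longrightarrow> S \<in> I) \<and>
     (\<forall>T \<in> Lop sX sY. (\<exists>f \<in> Dual sX. \<exists>y. \<forall>x. blinfun_apply T x = sY (blinfun_apply f x) y) \<longrightarrow> T \<in> I)"

end

theory Submission
  imports Defs
begin

text \<open>
  By Zizler's iteration, \<open>T\<close> is perturbed by a convergent series of rank one operators to an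
  operator \<open>S\<close> with unit vectors \<open>x\<^sub>n\<close> and nested slices
  \<open>{y* : |y*(S\<^sub>n x\<^sub>n)| \<ge> c\<^sub>n}\<close> of the dual ball on whose intersection \<open>y* \<mapsto> \<parallel>y* \<circ> S\<parallel>\<close> attains its
  maximum. The intersection is weak-star compact and, being the complement of an increasing union of
  convex sets, it has a convex complement in the dual ball, so it contains an extreme point \<open>e\<close> of
  the dual ball. Property quasi-\<open>\<beta>\<close> then provides \<open>g \<in> A\<close> near a rotation of \<open>e\<close> with
  \<open>\<parallel>g \<circ> S\<parallel>\<close> as close to \<open>\<parallel>S\<parallel>\<close> as desired and \<open>\<rho>(g)\<close> bounded away from 1. For \<open>x*\<close> in \<open>SE(X)\<close> near
  \<open>g \<circ> S\<close>, the operator \<open>S + ((1 + \<eta>) x* - g \<circ> S) \<otimes> \<sigma>(g)\<close> is composed by \<open>g\<close> to \<open>(1 + \<eta>) x*\<close>, whereas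
  all other \<open>h \<in> A\<close> stay below its norm by a fixed gap, so it inherits strong exposedness from \<open>x*\<close>.
\<close>

section \<open>Extreme points in sets with convex complement\<close>

text \<open>A maximal proper relatively open convex subset \<open>C\<close> of \<open>K\<close> containing \<open>K - F\<close> has as its
  complement a face of \<open>K\<close>, and this face is a single point, since otherwise a linear functional
  would cut off a larger \<open>C\<close>.\<close>

lemma compact_coconvex_contains_extreme_point:
  fixes K F :: "'v::real_vector set" and T :: "'v topology"
  assumes top: "topspace T = K" and comp: "compact_space T" and conv: "convex K"
    and cont: "\<And>x u. x \<in> K \<Longrightarrow> 0 < u \<Longrightarrow> u < 1 \<Longrightarrow>
                 continuous_map T T (\<lambda>y. u *\<^sub>R y + (1 - u) *\<^sub>R x)"
    and lim: "\<And>x y u. x \<in> K \<Longrightarrow> y \<in> K \<Longrightarrow> 0 < u \<Longrightarrow> u < 1 \<Longrightarrow>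
                 limitin T (\<lambda>n. u ^ n *\<^sub>R y + (1 - u ^ n) *\<^sub>R x) x sequentially"
    and sep: "\<And>a b. a \<in> K \<Longrightarrow> b \<in> K \<Longrightarrow> a \<noteq> b \<Longrightarrow>
                 \<exists>\<phi>. linear \<phi> \<and> continuous_map T euclideanreal \<phi> \<and> \<phi> a < \<phi> b"
    and F: "closedin T F" "F \<noteq> {}" "convex (K - F)"
  shows "\<exists>e\<in>F. e extreme_point_of K"
proof -
  define \<C> where "\<C> = {C. openin T C \<and> convex C \<and> C \<noteq> K \<and> K - F \<subseteq> C}"
  have FK: "F \<subseteq> K" using F(1) top closedin_subset by blast
  have "\<exists>C\<in>\<C>. \<forall>X\<in>\<C>. C \<subseteq> X \<longrightarrow> X = C"
  proof (rule subset_Zorn_nonempty)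
    have "K - F \<in> \<C>"
      using F FK top unfolding \<C>_def by (auto simp: closedin_def)
    then show "\<C> \<noteq> {}" by blast
  next
    fix \<D> assume ne: "\<D> \<noteq> {}" and ch: "subset.chain \<C> \<D>"
    have sub: "\<D> \<subseteq> \<C>" and tot: "\<And>X Y. X \<in> \<D> \<Longrightarrow> Y \<in> \<D> \<Longrightarrow> X \<subseteq> Y \<or> Y \<subseteq> X"
      using ch unfolding subset.chain_def by blast+
    have op: "openin T (\<Union>\<D>)" using sub unfolding \<C>_def by blast
    have "convex (\<Union>\<D>)"
    proof (rule convexI)
      fix x y and u v :: real
      assume "x \<in> \<Union>\<D>" "y \<in> \<Union>\<D>" and uv: "0 \<le> u" "0 \<le> v" "u + v = 1"
      then obtain X Y where XY: "X \<in> \<D>" "Y \<in> \<D>" "x \<in> X" "y \<in> Y" by blast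
      then obtain Z where "Z \<in> \<D>" "x \<in> Z" "y \<in> Z" using tot[of X Y] by blast
      moreover from this have "convex Z" using sub unfolding \<C>_def by blast
      ultimately show "u *\<^sub>R x + v *\<^sub>R y \<in> \<Union>\<D>" using uv convexD by blast
    qed
    moreover have "\<Union>\<D> \<noteq> K"
    proof
      \<comment> \<open>By compactness finitely many members cover \<open>K\<close>; the largest of
        them in the chain would then equal \<open>K\<close>, but members of \<open>\<C>\<close> are
        proper subsets.\<close>
      assume "\<Union>\<D> = K"
      then obtain \<F> where f: "finite \<F>" "\<F> \<subseteq> \<D>" "K \<subseteq> \<Union>\<F>"
        using comp top sub unfolding compact_space_alt \<C>_def
        by (smt (verit, best) mem_Collect_eq order_refl subset_iff)
      have "\<F> \<noteq> {}" using f(3) FK F(2) by auto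
      moreover have "subset.chain \<C> \<F>"
        using f(2) ch unfolding subset.chain_def by blast
      ultimately have "\<Union>\<F> \<in> \<F>" using f(1) Union_in_chain by blast
      then have "\<Union>\<F> \<in> \<C>" using f(2) sub by blast
      moreover from this have "\<Union>\<F> \<subseteq> K" using top openin_subset unfolding \<C>_def by blast
      ultimately show False using f(3) unfolding \<C>_def by blast
    qed
    ultimately show "\<Union>\<D> \<in> \<C>" using op ne sub unfolding \<C>_def by blast
  qed
  then obtain C where C: "C \<in> \<C>" and max: "\<And>X. X \<in> \<C> \<Longrightarrow> C \<subseteq> X \<Longrightarrow> X = C" by blast
  have opC: "openin T C" and cC: "convex C" and CneK: "C \<noteq> K" and KFC: "K - F \<subseteq> C"
    using C unfolding \<C>_def by auto
  have CK: "C \<subseteq> K" using opC openin_subset top by blast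
  \<comment> \<open>\<open>pre x u\<close> is the preimage of \<open>C\<close> under the contraction
    of \<open>K\<close> towards \<open>x\<close> with ratio \<open>u\<close>. It is open and convex
    like \<open>C\<close>, so once it contains \<open>C\<close>, maximality of \<open>C\<close>
    leaves only the values \<open>C\<close> and \<open>K\<close>.\<close>
  define pre where "pre x u = {y \<in> K. u *\<^sub>R y + (1 - u) *\<^sub>R x \<in> C}" for x and u :: real
  have pre_cases: "pre x u = C \<or> pre x u = K"
    if "x \<in> K" "0 < u" "u < 1" "C \<subseteq> pre x u" for x u
  proof (rule ccontr)
    assume H: "\<not> (pre x u = C \<or> pre x u = K)"
    have "openin T (pre x u)"
      using openin_continuous_map_preimage[OF cont[OF that(1-3)] opC] top
      unfolding pre_def by simp
    moreover have "convex (pre x u)"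
    proof (rule convexI)
      fix y z and s t :: real
      assume yz: "y \<in> pre x u" "z \<in> pre x u" and st: "0 \<le> s" "0 \<le> t" "s + t = 1"
      have "s *\<^sub>R y + t *\<^sub>R z \<in> K"
        using yz conv st unfolding pre_def by (blast intro: convexD)
      moreover have "s *\<^sub>R (u *\<^sub>R y + (1 - u) *\<^sub>R x) + t *\<^sub>R (u *\<^sub>R z + (1 - u) *\<^sub>R x) \<in> C"
        using yz cC st unfolding pre_def by (blast intro: convexD)
      moreover have "s *\<^sub>R (u *\<^sub>R y + (1 - u) *\<^sub>R x) + t *\<^sub>R (u *\<^sub>R z + (1 - u) *\<^sub>R x)
          = u *\<^sub>R (s *\<^sub>R y + t *\<^sub>R z) + ((s + t) * (1 - u)) *\<^sub>R x"
        by (simp add: algebra_simps)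
      ultimately show "s *\<^sub>R y + t *\<^sub>R z \<in> pre x u" using st unfolding pre_def by simp
    qed
    ultimately have "pre x u \<in> \<C>" using H KFC that(4) unfolding \<C>_def by blast
    then show False using max that(4) H by blast
  qed
  \<comment> \<open>If this failed, \<open>pre x u\<close> would be \<open>C\<close>, so iterating
    the contraction from \<open>y\<close> would never enter \<open>C\<close>; but the iterates
    converge to \<open>x\<close>, which lies in the open set \<open>C\<close>.\<close>
  have seg: "u *\<^sub>R y + (1 - u) *\<^sub>R x \<in> C" if "x \<in> C" "y \<in> K" "0 < u" "u < 1" for x y u
  proof (rule ccontr)
    assume H: "u *\<^sub>R y + (1 - u) *\<^sub>R x \<notin> C"
    have xK: "x \<in> K" using that CK by blast
    have "C \<subseteq> pre x u"
      using that cC CK unfolding pre_def by (auto intro: convexD)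
    then have pre: "pre x u = C" using pre_cases[OF xK that(3,4)] H that(2) unfolding pre_def by blast
    have "u ^ n *\<^sub>R y + (1 - u ^ n) *\<^sub>R x \<in> K - C" for n
    proof (induction n)
      case 0
      have "y \<notin> C" using H pre unfolding pre_def by (metis (mono_tags, lifting) mem_Collect_eq)
      then show ?case using that by simp
    next
      case (Suc n)
      let ?z = "u ^ n *\<^sub>R y + (1 - u ^ n) *\<^sub>R x"
      have "?z \<notin> pre x u" using Suc pre by blast
      then have "u *\<^sub>R ?z + (1 - u) *\<^sub>R x \<notin> C" using Suc unfolding pre_def by blast
      moreover have "u *\<^sub>R ?z + (1 - u) *\<^sub>R x \<in> K"
        using Suc xK conv that by (auto intro: convexD)
      moreover have "u *\<^sub>R ?z + (1 - u) *\<^sub>R x = u ^ Suc n *\<^sub>R y + (1 - u ^ Suc n) *\<^sub>R x"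
        by (simp add: algebra_simps)
      ultimately show ?case by simp
    qed
    then have "\<forall>n. u ^ n *\<^sub>R y + (1 - u ^ n) *\<^sub>R x \<notin> C" by blast
    moreover have "\<forall>\<^sub>F n in sequentially. u ^ n *\<^sub>R y + (1 - u ^ n) *\<^sub>R x \<in> C"
      using lim[OF xK that(2-4)] opC that(1) unfolding limitin_def by blast
    ultimately show False by simp
  qed
  \<comment> \<open>\<open>K - C\<close> is convex: \<open>seg\<close> puts \<open>C\<close> inside
    \<open>pre x u\<close>, and \<open>x\<close>, fixed by the contraction, is not in
    \<open>pre x u\<close>; so \<open>pre x u\<close> is \<open>C\<close> and misses
    \<open>y\<close>.\<close>
  have segF: "u *\<^sub>R y + (1 - u) *\<^sub>R x \<in> K - C"
    if "x \<in> K - C" "y \<in> K - C" "0 < u" "u < 1" for x y u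
  proof -
    have "C \<subseteq> pre x u"
    proof
      fix z assume "z \<in> C"
      then have "(1 - u) *\<^sub>R x + (1 - (1 - u)) *\<^sub>R z \<in> C" using seg[of z x "1 - u"] that by simp
      then show "z \<in> pre x u" using \<open>z \<in> C\<close> CK unfolding pre_def by (auto simp: algebra_simps)
    qed
    moreover have "x \<notin> pre x u" using that unfolding pre_def by (simp add: algebra_simps)
    ultimately have "pre x u = C" using pre_cases[of x u] that by blast
    then have "u *\<^sub>R y + (1 - u) *\<^sub>R x \<notin> C" using that unfolding pre_def by blast
    moreover have "u *\<^sub>R y + (1 - u) *\<^sub>R x \<in> K"
      using conv that by (auto intro: convexD)
    ultimately show ?thesis by blast
  qed
  obtain e where e: "e \<in> K - C" using CK CneK by blast
  have single: "K - C = {e}"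
  proof (rule ccontr)
    assume "K - C \<noteq> {e}"
    then obtain b where b: "b \<in> K - C" "b \<noteq> e" using e by blast
    then obtain \<phi> a d where \<phi>: "linear \<phi>" "continuous_map T euclideanreal \<phi>"
      and ad: "a \<in> K - C" "d \<in> K - C" "\<phi> a < \<phi> d" using sep[of b e] e by blast
    \<comment> \<open>Adjoining an open half-space strictly enlarges \<open>C\<close>, as it
      captures \<open>a\<close>, and stays proper, as it omits \<open>d\<close>. This contradicts
      maximality.\<close>
    define C' where "C' = C \<union> {x \<in> K. \<phi> x < \<phi> d}"
    have "openin T {x \<in> K. \<phi> x < \<phi> d}"
      using openin_continuous_map_preimage[OF \<phi>(2), of "{..<\<phi> d}"] top by simp
    then have "openin T C'" unfolding C'_def using opC by blast
    moreover have "convex C'"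
    proof -
      have half: "u *\<^sub>R y + (1 - u) *\<^sub>R x \<in> C'"
        if "x \<in> C'" "y \<in> C'" "0 < u" "u < 1" for x y u
      proof (cases "x \<in> C \<or> y \<in> C")
        case True
        then show ?thesis
        proof
          assume "x \<in> C"
          then show ?thesis using seg[of x y u] that CK unfolding C'_def by blast
        next
          assume "y \<in> C"
          then have "(1 - u) *\<^sub>R x + (1 - (1 - u)) *\<^sub>R y \<in> C"
            using seg[of y x "1 - u"] that CK unfolding C'_def by auto
          then show ?thesis unfolding C'_def by (simp add: algebra_simps)
        qed
      next
        case False
        then have xy: "x \<in> K" "y \<in> K" "\<phi> x < \<phi> d" "\<phi> y < \<phi> d" using that unfolding C'_def by auto
        have "\<phi> (u *\<^sub>R y + (1 - u) *\<^sub>R x) = u * \<phi> y + (1 - u) * \<phi> x"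
          using \<phi>(1) by (simp add: linear_add linear_cmul)
        also have "\<dots> < u * \<phi> d + (1 - u) * \<phi> d"
          using that xy by (intro add_strict_mono mult_strict_left_mono) auto
        finally have "\<phi> (u *\<^sub>R y + (1 - u) *\<^sub>R x) < \<phi> d" by (simp add: algebra_simps)
        moreover have "u *\<^sub>R y + (1 - u) *\<^sub>R x \<in> K"
          using conv that xy by (auto intro: convexD)
        ultimately show ?thesis unfolding C'_def by blast
      qed
      show ?thesis
      proof (rule convexI)
        fix x y and u v :: real
        assume "x \<in> C'" "y \<in> C'" "0 \<le> u" "0 \<le> v" "u + v = 1"
        then show "u *\<^sub>R x + v *\<^sub>R y \<in> C'"
          using half[of y x u] by (cases "u = 0"; cases "u = 1") (auto simp: eq_diff_eq[symmetric] add.commute)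
      qed
    qed
    moreover have "d \<notin> C'" using ad unfolding C'_def by blast
    ultimately have "C' \<in> \<C>" using KFC ad unfolding C'_def \<C>_def by blast
    then have "C' = C" using max unfolding C'_def by blast
    then show False using ad unfolding C'_def by blast
  qed
  \<comment> \<open>By \<open>seg\<close>, an endpoint in \<open>C\<close> would pull the interior
    point \<open>e\<close> into \<open>C\<close>; so both endpoints lie in \<open>K - C\<close>,
    which is the single point \<open>e\<close>.\<close>
  have "e extreme_point_of K"
    unfolding extreme_point_of_def
  proof (intro conjI ballI notI)
    show "e \<in> K" using e by blast
    fix a b assume ab: "a \<in> K" "b \<in> K" "e \<in> open_segment a b"
    then obtain u where u: "0 < u" "u < 1" "a \<noteq> b" "e = (1 - u) *\<^sub>R a + u *\<^sub>R b"
      unfolding in_segment by auto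
    have "a \<notin> C" using seg[of a b u] ab u e by (auto simp: add.commute)
    moreover have "b \<notin> C" using seg[of b a "1 - u"] ab u e by auto
    ultimately show False using ab(1,2) u(3) single by (metis DiffI singletonD)
  qed
  moreover have "e \<in> F" using e KFC by blast
  ultimately show ?thesis by blast
qed

section \<open>Norming functionals\<close>

definition sublinear :: "('a::real_normed_vector \<Rightarrow> real) \<Rightarrow> bool" where
  "sublinear p \<longleftrightarrow> (\<forall>x y. p (x + y) \<le> p x + p y) \<and> (\<forall>t\<ge>0. \<forall>x. p (t *\<^sub>R x) \<le> t * p x)"

lemma sublinear_zero:
  assumes "sublinear p"
  shows "p 0 = 0"
proof -
  have "p (0 + 0) \<le> p 0 + p 0" using assms unfolding sublinear_def by blast
  moreover have "p (0 *\<^sub>R 0) \<le> 0 * p 0" using assms unfolding sublinear_def by blast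
  ultimately show ?thesis by simp
qed

lemma sublinear_neg_le:
  assumes "sublinear p"
  shows "- p (- x) \<le> p x"
proof -
  have "p (x + - x) \<le> p x + p (- x)" using assms unfolding sublinear_def by blast
  then show ?thesis using sublinear_zero[OF assms] by simp
qed

text \<open>The witness is \<open>q x = Inf {p (x + t y) - t p y | t \<ge> 0}\<close>. Taking
  \<open>t = 1\<close> at \<open>x = - y\<close> gives \<open>q (- y) \<le> - p y\<close>, so every
  linear functional below \<open>q\<close> is at least \<open>p y\<close> at
  \<open>y\<close>.\<close>

lemma sublinear_shift:
  assumes p: "sublinear p"
  obtains q where "sublinear q" "\<And>x. q x \<le> p x" "\<And>x t. 0 \<le> t \<Longrightarrow> q x \<le> p (x + t *\<^sub>R y) - t * p y"
proof
  define Q where "Q x = (\<lambda>t. p (x + t *\<^sub>R y) - t * p y) ` {0..}" for x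
  define q where "q x = Inf (Q x)" for x
  have add: "p (a + b) \<le> p a + p b" for a b using p unfolding sublinear_def by blast
  have sc: "t \<ge> 0 \<Longrightarrow> p (t *\<^sub>R a) \<le> t * p a" for t a using p unfolding sublinear_def by blast
  have sc': "p (t *\<^sub>R a) = t * p a" if "t > 0" for t a
  proof (rule antisym)
    have "t * p ((1/t) *\<^sub>R (t *\<^sub>R a)) \<le> t * ((1/t) * p (t *\<^sub>R a))"
      using that by (intro mult_left_mono sc) auto
    then show "t * p a \<le> p (t *\<^sub>R a)" using that by simp
  qed (use sc that in simp)
  have bdd: "bdd_below (Q x)" for x
  proof (rule bdd_belowI)
    fix z assume "z \<in> Q x"
    then obtain t where t: "t \<ge> 0" "z = p (x + t *\<^sub>R y) - t * p y" unfolding Q_def by auto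
    have "t * p y = p (t *\<^sub>R y)" using sc' t sublinear_zero[OF p] by (cases "t = 0") auto
    also have "\<dots> \<le> p (x + t *\<^sub>R y) + p (- x)" using add[of "x + t *\<^sub>R y" "- x"] by simp
    finally show "- p (- x) \<le> z" using t by simp
  qed
  have ne: "Q x \<noteq> {}" for x unfolding Q_def by simp
  show le: "q x \<le> p (x + t *\<^sub>R y) - t * p y" if "0 \<le> t" for x t
    unfolding q_def by (rule cInf_lower[OF _ bdd]) (use that in \<open>auto simp: Q_def\<close>)
  show "q x \<le> p x" for x using le[of 0 x] by simp
  have q_ge: "c \<le> q x" if "\<And>t. 0 \<le> t \<Longrightarrow> c \<le> p (x + t *\<^sub>R y) - t * p y" for c x
    unfolding q_def by (rule cInf_greatest[OF ne]) (use that in \<open>auto simp: Q_def\<close>)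
  show "sublinear q"
    unfolding sublinear_def
  proof (intro conjI allI impI)
    fix a b
    \<comment> \<open>For representatives \<open>s\<close> and \<open>t\<close> the shift
      \<open>s + t\<close> is used for \<open>a + b\<close>; the infimum is then taken over
      \<open>s\<close> first and over \<open>t\<close> afterwards.\<close>
    have "q (a + b) - (p (b + t *\<^sub>R y) - t * p y) \<le> q a" if "0 \<le> t" for t
    proof (rule q_ge)
      fix s :: real assume "0 \<le> s"
      have "q (a + b) \<le> p ((a + b) + (s + t) *\<^sub>R y) - (s + t) * p y"
        using le[of "s + t" "a + b"] that \<open>0 \<le> s\<close> by simp
      also have "(a + b) + (s + t) *\<^sub>R y = (a + s *\<^sub>R y) + (b + t *\<^sub>R y)"
        by (simp add: algebra_simps)
      finally show "q (a + b) - (p (b + t *\<^sub>R y) - t * p y) \<le> p (a + s *\<^sub>R y) - s * p y"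
        using add[of "a + s *\<^sub>R y" "b + t *\<^sub>R y"] by (simp add: algebra_simps)
    qed
    then have "q (a + b) - q a \<le> q b" by (intro q_ge) (simp add: algebra_simps)
    then show "q (a + b) \<le> q a + q b" by simp
  next
    fix t :: real and a assume t: "0 \<le> t"
    show "q (t *\<^sub>R a) \<le> t * q a"
    proof (cases "t = 0")
      case True
      then show ?thesis using le[of 0 0] sublinear_zero[OF p] by simp
    next
      case False
      have "q (t *\<^sub>R a) / t \<le> q a"
      proof (rule q_ge)
        fix s :: real assume s: "0 \<le> s"
        have "q (t *\<^sub>R a) \<le> p (t *\<^sub>R (a + s *\<^sub>R y)) - (t * s) * p y"
          using le[of "t * s" "t *\<^sub>R a"] s t by (simp add: algebra_simps)
        also have "\<dots> = t * (p (a + s *\<^sub>R y) - s * p y)"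
          using sc'[of t "a + s *\<^sub>R y"] t False by (simp only: right_diff_distrib mult.assoc)
        finally show "q (t *\<^sub>R a) / t \<le> p (a + s *\<^sub>R y) - s * p y"
          using t False by (simp add: divide_le_eq mult.commute)
      qed
      then show ?thesis using t False by (simp add: divide_le_eq mult.commute)
    qed
  qed
qed

text \<open>Zorn's lemma for the reversed pointwise order. A nonempty chain has its pointwise
  infimum as lower bound, which is finite because \<open>- p (- x) \<le> q x\<close> for every
  sublinear \<open>q \<le> p\<close>.\<close>

lemma minimal_sublinear:
  assumes p: "sublinear p"
  obtains m where "sublinear m" "\<And>x. m x \<le> p x"
    "\<And>q. sublinear q \<Longrightarrow> (\<And>x. q x \<le> m x) \<Longrightarrow> q = m"
proof -
  define A where "A = {q. sublinear q \<and> q \<le> p}"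
  have "\<exists>m\<in>A. \<forall>a\<in>A. m \<ge> a \<longrightarrow> a = m"
  proof (rule predicate_Zorn)
    show "partial_order_on A (relation_of (\<ge>) A)"
      by (rule partial_order_on_relation_ofI) auto
  next
    fix C assume C: "C \<in> Chains (relation_of (\<ge>) A)"
    then have CA: "C \<subseteq> A" and tot: "\<And>a b. a \<in> C \<Longrightarrow> b \<in> C \<Longrightarrow> a \<le> b \<or> b \<le> a"
      unfolding Chains_def relation_of_def by auto
    show "\<exists>u\<in>A. \<forall>a\<in>C. a \<ge> u"
    proof (cases "C = {}")
      case True
      then show ?thesis using p unfolding A_def by auto
    next
      case False
      define u where "u x = (INF q\<in>C. q x)" for x
      have "bdd_below ((\<lambda>q. q x) ` C)" for x
      proof (rule bdd_belowI2)
        fix q assume "q \<in> C"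
        then have "sublinear q" "q (- x) \<le> p (- x)" using CA unfolding A_def by (auto simp: le_fun_def)
        then show "- p (- x) \<le> q x" using sublinear_neg_le[of q x] by linarith
      qed
      then have le: "u x \<le> q x" if "q \<in> C" for q x
        unfolding u_def using that by (intro cINF_lower)
      have ge: "c \<le> u x" if "\<And>q. q \<in> C \<Longrightarrow> c \<le> q x" for c x
        unfolding u_def using False that by (intro cINF_greatest)
      have "sublinear u"
        unfolding sublinear_def
      proof (intro conjI allI impI)
        fix x y
        have "u (x + y) - q y \<le> u x" if q: "q \<in> C" for q
        proof (rule ge)
          fix q' assume q': "q' \<in> C"
          \<comment> \<open>The smaller of the two members of the chain serves for both
            \<open>q\<close> and \<open>q'\<close>, which makes the infimum subadditive.\<close>
          obtain r where r: "r \<in> C" "r \<le> q" "r \<le> q'" using tot q q' by blast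
          have "u (x + y) \<le> r (x + y)" using le r by blast
          also have "\<dots> \<le> r x + r y" using r(1) CA unfolding A_def sublinear_def by blast
          also have "\<dots> \<le> q' x + q y" using r by (intro add_mono) (auto simp: le_fun_def)
          finally show "u (x + y) - q y \<le> q' x" by simp
        qed
        then have "u (x + y) - u x \<le> u y" by (intro ge) (simp add: algebra_simps)
        then show "u (x + y) \<le> u x + u y" by simp
      next
        fix t :: real and x assume t: "0 \<le> t"
        have *: "u (t *\<^sub>R x) \<le> t * q x" if "q \<in> C" for q
        proof -
          have "u (t *\<^sub>R x) \<le> q (t *\<^sub>R x)" using le that by blast
          also have "\<dots> \<le> t * q x" using that t CA unfolding A_def sublinear_def by blast
          finally show ?thesis .
        qed
        show "u (t *\<^sub>R x) \<le> t * u x"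
        proof (cases "t = 0")
          case True
          then show ?thesis using * False by auto
        next
          case nz: False
          have "u (t *\<^sub>R x) / t \<le> u x"
            using * t nz by (intro ge) (simp add: divide_le_eq mult.commute)
          then show ?thesis using t nz by (simp add: divide_le_eq mult.commute)
        qed
      qed
      moreover have "u \<le> p"
      proof -
        obtain q where "q \<in> C" using False by blast
        then show ?thesis using le CA unfolding A_def le_fun_def by (blast intro: order_trans)
      qed
      ultimately show ?thesis using le unfolding A_def by (auto simp: le_fun_def)
    qed
  qed
  then obtain m where m: "m \<in> A" "\<And>a. a \<in> A \<Longrightarrow> a \<le> m \<Longrightarrow> a = m" by blast
  show thesis
  proof
    show "sublinear m" "\<And>x. m x \<le> p x" using m(1) unfolding A_def by (auto simp: le_fun_def)
    fix q assume "sublinear q" "\<And>x. q x \<le> m x"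
    moreover from this have "q \<in> A"
      using m(1) unfolding A_def by (auto simp: le_fun_def intro: order_trans[of "q _" "m _"])
    ultimately show "q = m" using m(2) by (simp add: le_fun_def)
  qed
qed

text \<open>Minimality forces the shift of \<open>m\<close> along \<open>y\<close> to equal
  \<open>m\<close>; its defining bound at \<open>t = 1\<close> is then superadditivity.\<close>

lemma minimal_sublinear_linear:
  assumes m: "sublinear m"
    and min: "\<And>q. sublinear q \<Longrightarrow> (\<And>x. q x \<le> m x) \<Longrightarrow> q = m"
  shows "linear m"
proof -
  have sub: "m (x + y) \<le> m x + m y" for x y using m unfolding sublinear_def by blast
  have super: "m x + m y \<le> m (x + y)" for x y
  proof -
    obtain q where q: "sublinear q" "\<And>x. q x \<le> m x"
      "\<And>x t. 0 \<le> t \<Longrightarrow> q x \<le> m (x + t *\<^sub>R y) - t * m y"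
        using sublinear_shift[OF m, of y] by metis
    have "q = m" using min q by blast
    then show ?thesis using q(3)[of 1 x] by simp
  qed
  have add: "m (x + y) = m x + m y" for x y using sub[of x y] super[of x y] by linarith
  have neg: "m (- x) = - m x" for x using add[of x "- x"] sublinear_zero[OF m] by simp
  have le: "t \<ge> 0 \<Longrightarrow> m (t *\<^sub>R x) \<le> t * m x" for t x using m unfolding sublinear_def by blast
  have pos: "m (t *\<^sub>R x) = t * m x" if "t \<ge> 0" for t x
    using le[OF that, of x] le[OF that, of "- x"] by (simp add: neg)
  have "m (t *\<^sub>R x) = t * m x" for t x
    using pos[of t x] pos[of "- t" x] by (cases "t \<ge> 0") (auto simp: neg)
  then show ?thesis using add by (intro linearI) auto
qed

text \<open>Any minimal sublinear functional below the shift of the norm along \<open>y\<close> is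
  linear, lies below the norm, and cannot be smaller than \<open>norm y\<close> at
  \<open>y\<close>.\<close>

theorem hahn_banach_norming:
  fixes y :: "'a::real_normed_vector"
  obtains f :: "'a \<Rightarrow> real" where "linear f" "\<And>x. f x \<le> norm x" "f y = norm y"
proof -
  have "sublinear (norm :: 'a \<Rightarrow> real)"
    unfolding sublinear_def by (auto intro: norm_triangle_ineq)
  then obtain q :: "'a \<Rightarrow> real" where q: "sublinear q" "\<And>x. q x \<le> norm x"
    "\<And>x t. 0 \<le> t \<Longrightarrow> q x \<le> norm (x + t *\<^sub>R y) - t * norm y"
    using sublinear_shift[of norm y] by metis
  obtain m where m: "sublinear m" "\<And>x. m x \<le> q x"
    "\<And>q. sublinear q \<Longrightarrow> (\<And>x. q x \<le> m x) \<Longrightarrow> q = m"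
    using minimal_sublinear[OF q(1)] by metis
  have lin: "linear m" using minimal_sublinear_linear m(1,3) by blast
  have "m (- y) \<le> - norm y" using m(2)[of "- y"] q(3)[of 1 "- y"] by simp
  then have "norm y \<le> m y" using lin by (simp add: linear_neg)
  moreover have le: "m x \<le> norm x" for x using m(2)[of x] q(2)[of x] by linarith
  ultimately have "m y = norm y" using le[of y] by linarith
  then show thesis using that lin le by blast
qed

text \<open>The Hahn-Banach conclusion over the scalar field, isolated so that everything after its
  real and complex proofs is uniform in the scalars.\<close>

definition norming_dual :: "('k::real_normed_field \<Rightarrow> 'y::banach \<Rightarrow> 'y) \<Rightarrow> bool" where
  "norming_dual sY \<longleftrightarrow>
     (\<forall>y. \<exists>g \<in> Dual sY. norm g \<le> 1 \<and> blinfun_apply g y = of_real (norm y))"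

lemma norming_dual_real: "norming_dual (scaleR :: real \<Rightarrow> 'y::banach \<Rightarrow> 'y)"
  unfolding norming_dual_def
proof
  fix y :: 'y
  obtain f :: "'y \<Rightarrow> real" where f: "linear f" "\<And>x. f x \<le> norm x" "f y = norm y"
    using hahn_banach_norming[of y] by metis
  have abs: "norm (f x) \<le> 1 * norm x" for x
    using f(2)[of x] f(2)[of "- x"] f(1) by (simp add: linear_neg abs_le_iff)
  then have bl: "bounded_linear f"
    using f(1) by (intro bounded_linear_intro[where K = 1]) (auto simp: linear_add linear_cmul)
  then have app: "blinfun_apply (Blinfun f) = f" by (rule bounded_linear_Blinfun_apply)
  have "Blinfun f \<in> Dual (scaleR :: real \<Rightarrow> 'y \<Rightarrow> 'y)"
    using f(1) unfolding Dual_def by (simp add: app linear_cmul)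
  moreover have "norm (Blinfun f) \<le> 1"
    using abs by (intro norm_blinfun_bound) (auto simp: app)
  ultimately show "\<exists>g\<in>Dual (scaleR :: real \<Rightarrow> 'y \<Rightarrow> 'y). norm g \<le> 1 \<and> blinfun_apply g y = of_real (norm y)"
    using app f(3) by (intro bexI[of _ "Blinfun f"]) auto
qed

lemma norming_dual_complex:
  fixes sY :: "complex \<Rightarrow> 'y::banach \<Rightarrow> 'y"
  assumes "kbanach sY"
  shows "norming_dual sY"
  unfolding norming_dual_def
proof
  fix y :: 'y
  have sadd: "sY a (x + z) = sY a x + sY a z" and addl: "sY (a + b) x = sY a x + sY b x"
    and smul: "sY a (sY b x) = sY (a * b) x" and sreal: "sY (of_real r) x = r *\<^sub>R x"
    and snorm: "norm (sY a x) = cmod a * norm x" for a b x z r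
    using assms unfolding kbanach_def by blast+
  obtain f :: "'y \<Rightarrow> real" where f: "linear f" "\<And>x. f x \<le> norm x" "f y = norm y"
    using hahn_banach_norming[of y] by metis
  \<comment> \<open>This is the unique complex-linear functional with real part
    \<open>f\<close>.\<close>
  define g where "g x = Complex (f x) (- f (sY \<i> x))" for x
  have s_scaleR: "sY a (r *\<^sub>R x) = r *\<^sub>R sY a x" for a r x
    by (metis sreal smul mult.commute)
  have gadd: "g (x + z) = g x + g z" for x z
    unfolding g_def using f(1) by (simp add: sadd linear_add complex_eq_iff)
  have g_scaleR: "g (r *\<^sub>R x) = r *\<^sub>R g x" for r x
    unfolding g_def using f(1) by (simp add: s_scaleR linear_cmul complex_eq_iff)
  have sone: "sY (-1) x = - x" for x using sreal[of "-1" x] by simp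
  have g_i: "g (sY \<i> x) = \<i> * g x" for x
    unfolding g_def using f(1) by (simp add: smul sone linear_neg complex_eq_iff)
  have g_scale: "g (sY a x) = a * g x" for a x
  proof -
    have "sY a x = sY (of_real (Re a) + of_real (Im a) * \<i>) x"
      using complex_eq[of a] by (simp add: mult.commute)
    also have "\<dots> = Re a *\<^sub>R x + Im a *\<^sub>R sY \<i> x"
      by (simp add: addl sreal smul[symmetric])
    finally have "g (sY a x) = Re a *\<^sub>R g x + Im a *\<^sub>R (\<i> * g x)"
      by (simp add: gadd g_scaleR g_i)
    also have "\<dots> = a * g x" by (simp add: complex_eq_iff)
    finally show ?thesis .
  qed
  have gn: "norm (g x) \<le> 1 * norm x" for x
  proof (cases "g x = 0")
    case False
    \<comment> \<open>Rotating \<open>x\<close> by \<open>t\<close> makes the value of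
      \<open>g\<close> real, where it equals \<open>f\<close>; so the bound on \<open>f\<close>
      carries over to the modulus of \<open>g\<close>.\<close>
    define t where "t = of_real (cmod (g x)) / g x"
    have t: "cmod t = 1" using False unfolding t_def by (simp add: norm_divide)
    have "g (sY t x) = of_real (cmod (g x))" using False by (simp add: g_scale t_def)
    then have "cmod (g x) = f (sY t x)" unfolding g_def by (simp add: complex_eq_iff)
    also have "\<dots> \<le> norm (sY t x)" by (rule f(2))
    finally show ?thesis using t by (simp add: snorm)
  qed simp
  have "bounded_linear g"
    using gn by (intro bounded_linear_intro[where K = 1]) (auto simp: gadd g_scaleR)
  then have app: "blinfun_apply (Blinfun g) = g" by (rule bounded_linear_Blinfun_apply)
  have nrm: "norm (Blinfun g) \<le> 1" using gn by (intro norm_blinfun_bound) (auto simp: app)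
  have "g y = of_real (norm y)"
  proof -
    have re: "Re (g y) = norm y" unfolding g_def by (simp add: f(3))
    \<comment> \<open>The real part of \<open>g y\<close> already equals the bound
      \<open>norm y\<close> on the modulus, leaving nothing for the imaginary part.\<close>
    have "(Re (g y))\<^sup>2 + (Im (g y))\<^sup>2 \<le> (norm y)\<^sup>2"
      using gn[of y] power_mono[of "cmod (g y)" "norm y" 2] by (simp add: cmod_power2)
    then have "Im (g y) = 0" unfolding re by simp
    then show ?thesis using re by (simp add: complex_eq_iff)
  qed
  then show "\<exists>g\<in>Dual sY. norm g \<le> 1 \<and> blinfun_apply g y = of_real (norm y)"
    using nrm g_scale by (intro bexI[of _ "Blinfun g"]) (auto simp: app Dual_def)
qed

section \<open>Scalar fields and rank one operators\<close>

text \<open>Common interface to the real and complex scalars. \<open>rotate\<close> turns moduli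
  into values of \<open>re\<close>, and \<open>heine_borel\<close> supplies the compact scalar balls
  behind weak-star compactness.\<close>

locale real_part =
  fixes re :: "'k::{real_normed_field,heine_borel} \<Rightarrow> real"
  assumes linear_re: "linear re"
    and re_le_norm: "re a \<le> norm a"
    and re_of_real: "re (of_real r) = r"
    and rotate: "\<exists>t. norm t = 1 \<and> t * a = of_real (norm a)"

lemma
  assumes "kbanach s"
  shows kbanach_add_right: "s a (x + y) = s a x + s a y"
    and kbanach_add_left: "s (a + b) x = s a x + s b x"
    and kbanach_mult: "s a (s b x) = s (a * b) x"
    and kbanach_of_real: "s (of_real r) x = r *\<^sub>R x"
    and kbanach_norm: "norm (s a x) = norm a * norm x"
  using assms unfolding kbanach_def by blast+

lemma kbanach_scaleR_left:
  assumes "kbanach s"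
  shows "s (r *\<^sub>R a) x = r *\<^sub>R s a x"
proof -
  have "s (r *\<^sub>R a) x = s (of_real r) (s a x)"
    by (simp only: kbanach_mult[OF assms] scaleR_conv_of_real)
  then show ?thesis by (simp only: kbanach_of_real[OF assms])
qed

lemma kbanach_scaleR_right:
  assumes "kbanach s"
  shows "s a (r *\<^sub>R x) = r *\<^sub>R s a x"
proof -
  have "s a (s (of_real r) x) = s (of_real r) (s a x)"
    by (simp only: kbanach_mult[OF assms] mult.commute)
  then show ?thesis by (simp only: kbanach_of_real[OF assms])
qed

definition rank_one :: "('k::real_normed_field \<Rightarrow> 'y::banach \<Rightarrow> 'y) \<Rightarrow> ('x::banach \<Rightarrow>\<^sub>L 'k) \<Rightarrow> 'y \<Rightarrow> 'x \<Rightarrow>\<^sub>L 'y"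
  where "rank_one sY f y = Blinfun (\<lambda>x. sY (blinfun_apply f x) y)"

lemma rank_one_apply:
  assumes "kbanach sY"
  shows "blinfun_apply (rank_one sY f y) x = sY (blinfun_apply f x) y"
proof -
  have "bounded_linear (\<lambda>x. sY (blinfun_apply f x) y)"
  proof (rule bounded_linear_intro)
    fix x
    show "norm (sY (blinfun_apply f x) y) \<le> norm x * (norm f * norm y)"
      using mult_right_mono[OF norm_blinfun[of f x], of "norm y"]
      by (simp add: kbanach_norm[OF assms] mult.commute mult.left_commute)
  qed (simp_all add: blinfun.add_right blinfun.scaleR_right kbanach_add_left[OF assms]
        kbanach_scaleR_left[OF assms])
  then show ?thesis unfolding rank_one_def by (simp add: bounded_linear_Blinfun_apply)
qed

lemma norm_rank_one_le:
  assumes "kbanach sY"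
  shows "norm (rank_one sY f y) \<le> norm f * norm y"
proof (rule norm_blinfun_bound)
  fix x
  show "norm (blinfun_apply (rank_one sY f y) x) \<le> norm f * norm y * norm x"
    using mult_right_mono[OF norm_blinfun[of f x], of "norm y"]
    by (simp add: rank_one_apply[OF assms] kbanach_norm[OF assms] mult_ac)
qed simp

lemma rank_one_in_Lop:
  assumes "kbanach sY" "f \<in> Dual sX"
  shows "rank_one sY f y \<in> Lop sX sY"
  using assms(2) unfolding Lop_def Dual_def
  by (simp add: rank_one_apply[OF assms(1)] kbanach_mult[OF assms(1)])

lemma add_in_Lop:
  assumes "kbanach sY" "S \<in> Lop sX sY" "T \<in> Lop sX sY"
  shows "S + T \<in> Lop sX sY"
  using assms(2,3) unfolding Lop_def
  by (simp add: blinfun.add_left kbanach_add_right[OF assms(1)])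

lemma compose_in_Dual:
  assumes "g \<in> Dual sY" "S \<in> Lop sX sY"
  shows "g o\<^sub>L S \<in> Dual sX"
  using assms unfolding Dual_def Lop_def by simp

lemma scaleR_in_Dual: "f \<in> Dual sX \<Longrightarrow> c *\<^sub>R f \<in> Dual sX"
  unfolding Dual_def by (simp add: blinfun.scaleR_left)

lemma add_in_Dual: "f \<in> Dual sX \<Longrightarrow> g \<in> Dual sX \<Longrightarrow> f + g \<in> Dual sX"
  unfolding Dual_def by (simp add: blinfun.add_left algebra_simps)

lemma diff_in_Dual: "f \<in> Dual sX \<Longrightarrow> g \<in> Dual sX \<Longrightarrow> f - g \<in> Dual sX"
  unfolding Dual_def by (simp add: blinfun.diff_left algebra_simps)

lemma norm_blinfun_unit: "x \<in> cball 0 1 \<Longrightarrow> norm (blinfun_apply f x) \<le> norm f"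
  using norm_blinfun[of f x] mult_left_mono[of "norm x" 1 "norm f"] by simp

lemma norm_blinfun_unit_bound:
  assumes "0 \<le> b" "\<And>x. x \<in> cball 0 1 \<Longrightarrow> norm (blinfun_apply f x) \<le> b"
  shows "norm f \<le> b"
proof (rule norm_blinfun_bound)
  fix x
  show "norm (blinfun_apply f x) \<le> b * norm x"
  proof (cases "x = 0")
    case False
    have "norm (blinfun_apply f ((1 / norm x) *\<^sub>R x)) \<le> b" using False by (intro assms(2)) simp
    then show ?thesis using False by (simp add: blinfun.scaleR_right divide_le_eq)
  qed simp
qed (rule assms(1))

lemma norm_blinfun_approx:
  assumes "c < norm f"
  obtains x where "x \<in> cball 0 1" "c < norm (blinfun_apply f x)"
proof (cases "c < 0")
  case True
  then show thesis using that[of 0] by simp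
next
  case False
  then have "\<not> (\<forall>x\<in>cball 0 1. norm (blinfun_apply f x) \<le> c)"
    using norm_blinfun_unit_bound[of c f] assms by force
  then show thesis using that by force
qed

section \<open>Slices of the dual ball\<close>

text \<open>On scalar-valued operators the strong operator topology is the weak-star topology.\<close>

lemma compactin_dual_ball:
  fixes sY :: "'k::{real_normed_field,heine_borel} \<Rightarrow> 'y::banach \<Rightarrow> 'y"
  assumes "kbanach sY"
  shows "compactin strong_operator_topology (Dual sY \<inter> cball 0 1)"
proof -
  let ?K = "Dual sY \<inter> cball 0 1"
  \<comment> \<open>Banach-Alaoglu: as functions on \<open>'y\<close>, the elements of the dual ball
    are exactly the points of the compact product \<open>B\<close> that satisfy the closed linearity
    conditions \<open>L\<close>.\<close>
  define B where "B = PiE (UNIV :: 'y set) (\<lambda>y. cball (0::'k) (norm y))"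
  define L where "L = {\<phi>. (\<forall>x y. \<phi> (x + y) = \<phi> x + \<phi> y) \<and> (\<forall>a x. \<phi> (sY a x) = a * \<phi> x)}"
  have "compactin (product_topology (\<lambda>_. euclidean) UNIV) B"
    unfolding B_def compactin_PiE by simp
  then have B: "compact B" by (simp add: euclidean_product_topology)
  have cont: "continuous_on UNIV (\<lambda>\<phi>::'y \<Rightarrow> 'k. \<phi> y)" for y
    by (rule continuous_on_product_coordinates)
  have "closed L"
    unfolding L_def
    by (intro closed_Collect_conj closed_Collect_all closed_Collect_eq continuous_intros cont)
  then have BL: "compact (B \<inter> L)" using B by (intro compact_Int_closed)
  have img: "blinfun_apply ` ?K = B \<inter> L"
  proof (intro equalityI subsetI)
    fix \<phi> assume "\<phi> \<in> blinfun_apply ` ?K"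
    then obtain g where g: "g \<in> ?K" "\<phi> = blinfun_apply g" by blast
    have "norm (blinfun_apply g x) \<le> norm x" for x
      using norm_blinfun[of g x] mult_right_mono[of "norm g" 1 "norm x"] g(1) by simp
    then show "\<phi> \<in> B \<inter> L" using g unfolding B_def L_def Dual_def
      by (auto simp: blinfun.add_right)
  next
    fix \<phi> assume \<phi>: "\<phi> \<in> B \<inter> L"
    then have n: "norm (\<phi> x) \<le> 1 * norm x" for x unfolding B_def by (auto simp: PiE_iff)
    have "\<phi> (r *\<^sub>R x) = r *\<^sub>R \<phi> x" for r x
    proof -
      have "\<phi> (sY (of_real r) x) = of_real r * \<phi> x" using \<phi> unfolding L_def by blast
      then show ?thesis by (simp add: kbanach_of_real[OF assms] scaleR_conv_of_real)
    qed
    then have "bounded_linear \<phi>"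
      using \<phi> n unfolding L_def by (intro bounded_linear_intro[where K = 1]) (auto simp: mult.commute)
    then have app: "blinfun_apply (Blinfun \<phi>) = \<phi>" by (rule bounded_linear_Blinfun_apply)
    have "norm (Blinfun \<phi>) \<le> 1" using n by (intro norm_blinfun_bound) (auto simp: app)
    then have "Blinfun \<phi> \<in> ?K" using \<phi> unfolding L_def Dual_def by (simp add: app)
    then show "\<phi> \<in> blinfun_apply ` ?K" using app by (metis image_eqI)
  qed
  \<comment> \<open>Inverting the embedding is continuous, since continuity into the strong operator
    topology is tested one evaluation at a time; the dual ball is thus a continuous image of a
    compact set.\<close>
  let ?j = "inv_into UNIV (blinfun_apply :: ('y \<Rightarrow>\<^sub>L 'k) \<Rightarrow> _)"
  have inj: "inj (blinfun_apply :: ('y \<Rightarrow>\<^sub>L 'k) \<Rightarrow> _)" by (simp add: inj_def blinfun_apply_inject)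
  have "continuous_map (top_of_set (B \<inter> L)) strong_operator_topology ?j"
    unfolding continuous_on_strong_operator_topo_iff_coordinatewise
  proof
    fix y
    have "continuous_map (top_of_set (B \<inter> L)) euclidean (\<lambda>\<phi>. \<phi> y)"
      using continuous_on_subset[OF cont] by simp
    then show "continuous_map (top_of_set (B \<inter> L)) euclidean (\<lambda>\<phi>. blinfun_apply (?j \<phi>) y)"
    proof (rule continuous_map_eq)
      fix \<phi> assume "\<phi> \<in> topspace (top_of_set (B \<inter> L))"
      then have "\<phi> \<in> range (blinfun_apply :: ('y \<Rightarrow>\<^sub>L 'k) \<Rightarrow> _)" using img by auto
      then show "\<phi> y = blinfun_apply (?j \<phi>) y" by (simp add: f_inv_into_f)
    qed
  qed
  moreover have "compactin (top_of_set (B \<inter> L)) (B \<inter> L)" using BL by (simp add: compactin_subtopology)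
  ultimately have "compactin strong_operator_topology (?j ` (B \<inter> L))" by (rule image_compactin[rotated])
  moreover have "?j ` (B \<inter> L) = ?K" unfolding img[symmetric] by (simp add: image_image inv_f_f[OF inj])
  ultimately show ?thesis by simp
qed

context real_part
begin

text \<open>The abstract result applies to the dual ball with its weak-star topology: evaluations
  are continuous, and real parts of rotated evaluations separate points.\<close>

lemma dual_ball_coconvex_extreme_point:
  fixes sY :: "'k \<Rightarrow> 'y::banach \<Rightarrow> 'y"
  assumes k: "kbanach sY"
    and F: "closedin (subtopology strong_operator_topology (Dual sY \<inter> cball 0 1)) F" "F \<noteq> {}"
      "convex (Dual sY \<inter> cball 0 1 - F)"
  shows "\<exists>e\<in>F. e extreme_point_of (Dual sY \<inter> cball 0 1)"
proof (rule compact_coconvex_contains_extreme_point)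
  let ?K = "Dual sY \<inter> cball 0 1"
  let ?T = "subtopology strong_operator_topology ?K"
  show "topspace ?T = ?K" by (simp add: strong_operator_topology_topspace)
  show "compact_space ?T"
    using compactin_dual_ball[OF k] by (simp add: compactin_subspace)
  have ev: "continuous_map ?T euclidean (\<lambda>g. blinfun_apply g x)" for x
    by (intro continuous_map_from_subtopology strong_operator_topology_continuous_evaluation)
  show conv: "convex ?K"
  proof (rule convex_Int)
    show "convex (Dual sY)" by (intro convexI add_in_Dual scaleR_in_Dual)
  qed simp
  have comb: "u *\<^sub>R y + (1 - u) *\<^sub>R x \<in> ?K" if "x \<in> ?K" "y \<in> ?K" "0 < u" "u < 1" for x y and u :: real
    using convexD[OF conv that(2,1), of u "1 - u"] that by simp
  show "continuous_map ?T ?T (\<lambda>y. u *\<^sub>R y + (1 - u) *\<^sub>R x)"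
    if "x \<in> ?K" "0 < u" "u < 1" for x and u :: real
  proof (rule continuous_map_into_subtopology)
    show "continuous_map ?T strong_operator_topology (\<lambda>y. u *\<^sub>R y + (1 - u) *\<^sub>R x)"
      unfolding continuous_on_strong_operator_topo_iff_coordinatewise
    proof
      fix z
      have "continuous_map euclidean euclidean (\<lambda>c::'k. u *\<^sub>R c + blinfun_apply ((1 - u) *\<^sub>R x) z)"
        by (auto intro!: continuous_intros)
      from continuous_map_compose[OF ev this]
      show "continuous_map ?T euclidean (\<lambda>y. blinfun_apply (u *\<^sub>R y + (1 - u) *\<^sub>R x) z)"
        by (simp add: o_def blinfun.add_left blinfun.scaleR_left)
    qed
  qed (use comb that in \<open>auto simp: Pi_iff\<close>)
  show "limitin ?T (\<lambda>n. u ^ n *\<^sub>R y + (1 - u ^ n) *\<^sub>R x) x sequentially"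
    if "x \<in> ?K" "y \<in> ?K" "0 < u" "u < 1" for x y and u :: real
  proof -
    \<comment> \<open>Convergence already holds in norm and passes to the weaker topology.\<close>
    have "(\<lambda>n. u ^ n) \<longlonglongrightarrow> 0" using that by (simp add: LIMSEQ_realpow_zero)
    then have "(\<lambda>n. u ^ n *\<^sub>R y + (1 - u ^ n) *\<^sub>R x) \<longlonglongrightarrow> 0 *\<^sub>R y + (1 - 0) *\<^sub>R x"
      by (intro tendsto_add tendsto_scaleR tendsto_diff tendsto_const)
    then have "limitin euclidean (\<lambda>n. u ^ n *\<^sub>R y + (1 - u ^ n) *\<^sub>R x) x sequentially" by simp
    from continuous_map_limit[OF strong_operator_topology_weaker_than_euclidean this]
    have "limitin strong_operator_topology (\<lambda>n. u ^ n *\<^sub>R y + (1 - u ^ n) *\<^sub>R x) x sequentially"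
      by (simp add: o_def)
    moreover have "u ^ n *\<^sub>R y + (1 - u ^ n) *\<^sub>R x \<in> ?K" for n
      using convexD[OF conv that(2,1), of "u ^ n" "1 - u ^ n"] that by (simp add: power_le_one)
    ultimately show ?thesis using that unfolding limitin_subtopology by auto
  qed
  show "\<exists>\<phi>. linear \<phi> \<and> continuous_map ?T euclideanreal \<phi> \<and> \<phi> a < \<phi> b"
    if ab: "a \<in> ?K" "b \<in> ?K" "a \<noteq> b" for a b
  proof -
    obtain y where y: "blinfun_apply a y \<noteq> blinfun_apply b y"
      using ab(3) blinfun_eqI by blast
    \<comment> \<open>Rotating by \<open>t\<close> makes \<open>\<phi> b - \<phi> a\<close> the full
      modulus of the difference of the values at \<open>y\<close>, hence positive.\<close>
    obtain t where t: "norm t = 1" "t * (blinfun_apply b y - blinfun_apply a y)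
        = of_real (norm (blinfun_apply b y - blinfun_apply a y))"
      using rotate by blast
    define \<phi> where "\<phi> = (\<lambda>g :: 'y \<Rightarrow>\<^sub>L 'k. re (t * blinfun_apply g y))"
    have "linear (\<lambda>g :: 'y \<Rightarrow>\<^sub>L 'k. t * blinfun_apply g y)"
      by (intro linearI) (auto simp: blinfun.add_left blinfun.scaleR_left algebra_simps)
    from linear_compose[OF this linear_re] have lin: "linear \<phi>" by (simp add: \<phi>_def o_def)
    have bl: "bounded_linear re"
    proof (rule bounded_linear_intro[where K = 1])
      fix a show "norm (re a) \<le> norm a * 1"
        using re_le_norm[of a] re_le_norm[of "- a"] linear_re by (simp add: linear_neg abs_le_iff)
    qed (use linear_re in \<open>auto simp: linear_add linear_cmul\<close>)
    have "continuous_map euclidean euclideanreal (\<lambda>c. re (t * c))"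
      using bounded_linear.continuous_on[OF bl continuous_on_mult_left[OF continuous_on_id]] by simp
    from continuous_map_compose[OF ev[of y] this]
    have cont: "continuous_map ?T euclideanreal \<phi>" by (simp add: o_def \<phi>_def)
    have "\<phi> b - \<phi> a = norm (blinfun_apply b y - blinfun_apply a y)"
      unfolding \<phi>_def linear_diff[OF linear_re, symmetric]
      by (simp only: right_diff_distrib[symmetric] t(2) re_of_real)
    moreover have "0 < norm (blinfun_apply b y - blinfun_apply a y)" using y by simp
    ultimately have "\<phi> a < \<phi> b" by linarith
    then show ?thesis using lin cont by blast
  qed
qed (use F in auto)

lemma closedin_dual_ball_ge:
  fixes sY :: "'k \<Rightarrow> 'y::banach \<Rightarrow> 'y"
  shows "closedin (subtopology strong_operator_topology (Dual sY \<inter> cball 0 1))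
          {g \<in> Dual sY \<inter> cball 0 1. c \<le> norm (blinfun_apply g y)}"
proof -
  have "continuous_map (subtopology strong_operator_topology (Dual sY \<inter> cball 0 1))
          euclidean (\<lambda>g. blinfun_apply g y)"
    by (intro continuous_map_from_subtopology strong_operator_topology_continuous_evaluation)
  from closedin_continuous_map_preimage[OF this, of "{a. c \<le> norm a}"]
  show ?thesis
    by (simp add: strong_operator_topology_topspace closed_Collect_le continuous_intros)
qed

lemma convex_dual_ball_less:
  fixes sY :: "'k \<Rightarrow> 'y::banach \<Rightarrow> 'y"
  shows "convex {g \<in> Dual sY \<inter> cball 0 1. norm (blinfun_apply g y) < c}"
proof (rule convexI)
  fix g h and u v :: real
  assume gh: "g \<in> {g \<in> Dual sY \<inter> cball 0 1. norm (blinfun_apply g y) < c}"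
      "h \<in> {g \<in> Dual sY \<inter> cball 0 1. norm (blinfun_apply g y) < c}"
    and uv: "0 \<le> u" "0 \<le> v" "u + v = 1"
  have "u *\<^sub>R g + v *\<^sub>R h \<in> Dual sY" using gh by (intro add_in_Dual scaleR_in_Dual) auto
  moreover have "u *\<^sub>R g + v *\<^sub>R h \<in> cball 0 1"
    using gh uv by (intro convexD[OF convex_cball]) auto
  moreover have "norm (blinfun_apply (u *\<^sub>R g + v *\<^sub>R h) y) < c"
  proof -
    have "u *\<^sub>R blinfun_apply g y + v *\<^sub>R blinfun_apply h y \<in> ball 0 c"
      using gh uv by (intro convexD[OF convex_ball]) auto
    then show ?thesis by (simp add: blinfun.add_left blinfun.scaleR_left)
  qed
  ultimately show "u *\<^sub>R g + v *\<^sub>R h \<in> {g \<in> Dual sY \<inter> cball 0 1. norm (blinfun_apply g y) < c}" by simp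
qed

text \<open>The complement of a slice in the ball is a sublevel set of a seminorm, hence convex, and
  an increasing union of convex sets is convex. So the intersection of the slices, nonempty by
  compactness, has a convex complement and contains an extreme point.\<close>

lemma nested_slices_extreme_point:
  fixes sY :: "'k \<Rightarrow> 'y::banach \<Rightarrow> 'y" and y :: "nat \<Rightarrow> 'y"
  assumes k: "kbanach sY"
    and ne: "\<And>n. \<exists>g \<in> Dual sY \<inter> cball 0 1. c n \<le> norm (blinfun_apply g (y n))"
    and nested: "\<And>n g. g \<in> Dual sY \<inter> cball 0 1 \<Longrightarrow> c (Suc n) \<le> norm (blinfun_apply g (y (Suc n)))
                   \<Longrightarrow> c n \<le> norm (blinfun_apply g (y n))"
  shows "\<exists>e. e extreme_point_of (Dual sY \<inter> cball 0 1) \<and> (\<forall>n. c n \<le> norm (blinfun_apply e (y n)))"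
proof -
  let ?K = "Dual sY \<inter> cball 0 1"
  let ?T = "subtopology strong_operator_topology ?K"
  define C where "C n = {g \<in> ?K. c n \<le> norm (blinfun_apply g (y n))}" for n
  have cl: "closedin ?T (C n)" for n unfolding C_def by (rule closedin_dual_ball_ge)
  have dec: "decseq C"
  proof (intro decseq_SucI subsetI)
    fix n g assume "g \<in> C (Suc n)"
    then show "g \<in> C n" using nested[of g n] unfolding C_def by blast
  qed
  have "compact_space ?T" using compactin_dual_ball[OF k] by (simp add: compactin_subspace)
  moreover have "C n \<noteq> {}" for n using ne[of n] unfolding C_def by auto
  ultimately have "(\<Inter>n. C n) \<noteq> {}"
    using cl dec by (intro compact_space_imp_nest) auto
  moreover have "closedin ?T (\<Inter>n. C n)" using cl by (intro closedin_Inter) auto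
  moreover have "convex (?K - (\<Inter>n. C n))"
  proof -
    have "convex (\<Union>n. ?K - C n)"
    proof (rule convexI)
      fix g h and u v :: real
      assume "g \<in> (\<Union>n. ?K - C n)" "h \<in> (\<Union>n. ?K - C n)" and uv: "0 \<le> u" "0 \<le> v" "u + v = 1"
      then obtain m n where mn: "g \<in> ?K - C m" "h \<in> ?K - C n" by blast
      let ?l = "max m n"
      have "C ?l \<subseteq> C m" "C ?l \<subseteq> C n" using decseqD[OF dec] by simp_all
      then have "g \<in> ?K - C ?l" "h \<in> ?K - C ?l" using mn by auto
      moreover have "convex (?K - C ?l)"
      proof -
        have eq: "?K - C ?l = {g \<in> ?K. norm (blinfun_apply g (y ?l)) < c ?l}" unfolding C_def by auto
        show ?thesis unfolding eq by (rule convex_dual_ball_less)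
      qed
      ultimately have "u *\<^sub>R g + v *\<^sub>R h \<in> ?K - C ?l" using uv by (intro convexD) auto
      then show "u *\<^sub>R g + v *\<^sub>R h \<in> (\<Union>n. ?K - C n)" by blast
    qed
    moreover have "?K - (\<Inter>n. C n) = (\<Union>n. ?K - C n)" by auto
    ultimately show ?thesis by (simp only:)
  qed
  ultimately have "\<exists>e\<in>(\<Inter>n. C n). e extreme_point_of ?K"
    by (intro dual_ball_coconvex_extreme_point[OF k])
  then show ?thesis unfolding C_def by blast
qed

text \<open>A constant sequence of slices at height \<open>norm y\<close> suffices; the slice is
  nonempty by \<open>norming_dual\<close>.\<close>

lemma norming_extreme_point:
  fixes sY :: "'k \<Rightarrow> 'y::banach \<Rightarrow> 'y"
  assumes "kbanach sY" "norming_dual sY"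
  obtains e where "e extreme_point_of (Dual sY \<inter> cball 0 1)" "norm y \<le> norm (blinfun_apply e y)"
proof -
  obtain g where "g \<in> Dual sY" "norm g \<le> 1" "blinfun_apply g y = of_real (norm y)"
    using assms(2) unfolding norming_dual_def by blast
  then have "\<exists>g\<in>Dual sY \<inter> cball 0 1. norm y \<le> norm (blinfun_apply g y)"
    by (intro bexI[of _ g]) auto
  from nested_slices_extreme_point[OF assms(1), of "\<lambda>_. norm y" "\<lambda>_. y", OF this]
  show thesis using that by blast
qed

end

section \<open>Adjoints attaining their norm at extreme points\<close>

text \<open>The algebraic side of the hypotheses on \<open>I\<close>, tailored to perturbation by
  rank one operators. \<open>Lop\<close> and \<open>Kop\<close> share it, so a single density
  theorem covers all three conclusions.\<close>

definition rank_one_stable :: "('k::real_normed_field \<Rightarrow> 'x::banach \<Rightarrow> 'x) \<Rightarrow> ('k \<Rightarrow> 'y::banach \<Rightarrow> 'y)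
     \<Rightarrow> ('x \<Rightarrow>\<^sub>L 'y) set \<Rightarrow> bool" where
  "rank_one_stable sX sY I \<longleftrightarrow> I \<subseteq> Lop sX sY \<and> (\<forall>S \<in> I. \<forall>T \<in> I. S + T \<in> I) \<and>
     (\<forall>f \<in> Dual sX. \<forall>y. rank_one sY f y \<in> I)"

context real_part
begin

text \<open>Evaluation at \<open>y\<close> is continuous in the pointwise topology and the factor
  \<open>t\<close> leaves the modulus unchanged, so a strict lower bound at \<open>e\<close> is
  inherited by some member of \<open>A\<close>.\<close>

lemma norm_approx_in_closure:
  fixes A :: "('y::banach \<Rightarrow>\<^sub>L 'k) set"
  assumes "(\<lambda>y. t * blinfun_apply e y) \<in> closure (blinfun_apply ` A)" "norm t = 1"
    and "c < norm (blinfun_apply e y)"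
  obtains g where "g \<in> A" "c < norm (blinfun_apply g y)"
proof -
  let ?U = "{\<phi>::'y \<Rightarrow> 'k. c < norm (\<phi> y)}"
  have "continuous_on UNIV (\<lambda>\<phi>::'y \<Rightarrow> 'k. norm (\<phi> y))"
    by (rule continuous_on_norm[OF continuous_on_product_coordinates])
  then have U: "open ?U" by (rule open_Collect_less[OF continuous_on_const])
  have "(\<lambda>y. t * blinfun_apply e y) \<in> ?U \<inter> closure (blinfun_apply ` A)"
    using assms by (simp add: norm_mult)
  then have "?U \<inter> blinfun_apply ` A \<noteq> {}"
    using open_Int_closure_eq_empty[OF U, of "blinfun_apply ` A"] by (metis empty_iff)
  then obtain g where "g \<in> A" "c < norm (blinfun_apply g y)" by auto
  then show thesis by (rule that)
qed

text \<open>Zizler's rank-one perturbation. The slice of the dual ball cut out by the new operator lies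
  inside the given slice, which makes the slices of the iteration below nested.\<close>

lemma slice_refinement:
  fixes sX :: "'k \<Rightarrow> 'x::banach \<Rightarrow> 'x" and sY :: "'k \<Rightarrow> 'y::banach \<Rightarrow> 'y"
  assumes kY: "kbanach sY" and nd: "norming_dual sY"
    and I: "rank_one_stable sX sY I"
    and S: "S \<in> I" and c: "0 \<le> c" "c < norm S" and \<kappa>: "0 < \<kappa>"
  obtains S' c' x where "S' \<in> I" "x \<in> cball 0 1" "norm (S' - S) \<le> \<kappa>" "0 \<le> c'" "c' < norm S'"
    "norm S' - c' \<le> \<kappa>" "c \<le> norm (blinfun_apply S x)"
    "\<And>h x'. h \<in> Dual sY \<inter> cball 0 1 \<Longrightarrow> x' \<in> cball 0 1 \<Longrightarrow> c' \<le> norm (blinfun_apply h (blinfun_apply S' x'))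
        \<Longrightarrow> c \<le> norm (blinfun_apply h (blinfun_apply S x))"
proof -
  define M where "M = norm S"
  have M: "0 < M" "c < M" using c unfolding M_def by auto
  \<comment> \<open>\<open>\<epsilon>\<close> is scaled so that the rank one term, of norm at most
    \<open>\<epsilon> * M * M\<close>, has norm at most \<open>\<kappa>\<close>.\<close>
  define \<epsilon> where "\<epsilon> = \<kappa> / M\<^sup>2"
  have \<epsilon>: "0 < \<epsilon>" "\<epsilon> * M * M = \<kappa>" using \<kappa> M unfolding \<epsilon>_def by (auto simp: power2_eq_square)
  \<comment> \<open>\<open>\<gamma>\<close> bounds the loss in \<open>norm (S x)\<close>: replacing
    \<open>M\<close> by \<open>M - \<gamma>\<close> costs at most
    \<open>\<gamma> * (1 + 2 * \<epsilon> * M)\<close> in \<open>M + \<epsilon> * M * M\<close>,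
    which \<open>\<gamma>eq\<close> equates with the surplus over
    \<open>M + \<epsilon> * M * c\<close>.\<close>
  define \<gamma> where "\<gamma> = \<epsilon> * M * (M - c) / (1 + 2 * \<epsilon> * M)"
  have eM: "0 < \<epsilon> * M" using \<epsilon> M by simp
  have pos: "0 < 1 + 2 * \<epsilon> * M" using eM by simp
  have \<gamma>: "0 < \<gamma>" unfolding \<gamma>_def using pos M \<epsilon>(1) by (intro divide_pos_pos mult_pos_pos) auto
  have \<gamma>eq: "\<gamma> * (1 + 2 * \<epsilon> * M) = \<epsilon> * M * (M - c)"
    unfolding \<gamma>_def using pos by simp
  have \<gamma>_le: "\<gamma> \<le> M - c"
  proof -
    have "\<epsilon> * M * (M - c) \<le> (1 + 2 * \<epsilon> * M) * (M - c)"
      using eM M(2) by (intro mult_right_mono) linarith+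
    then have "\<gamma> * (1 + 2 * \<epsilon> * M) \<le> (M - c) * (1 + 2 * \<epsilon> * M)"
      using \<gamma>eq by (simp add: mult.commute)
    then show ?thesis using pos by (simp only: mult_le_cancel_right_pos)
  qed
  have "M - \<gamma> < norm S" using \<gamma> unfolding M_def by simp
  then obtain x where x: "x \<in> cball 0 1" "M - \<gamma> < norm (blinfun_apply S x)"
    by (rule norm_blinfun_approx)
  define y where "y = blinfun_apply S x"
  define s where "s = norm y"
  have s: "M - \<gamma> < s" "s \<le> M" "c \<le> s"
    using x \<gamma>_le norm_blinfun_unit[OF x(1), of S] unfolding s_def y_def M_def by auto
  have s0: "0 \<le> s" unfolding s_def by simp
  have key: "M + \<epsilon> * M * c < s + \<epsilon> * s * s"
  proof -
    have "(M - \<gamma>) * (M - \<gamma>) \<le> s * s"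
      using s s0 \<gamma>_le c by (intro mult_mono) auto
    then have "\<epsilon> * ((M - \<gamma>) * (M - \<gamma>)) \<le> \<epsilon> * (s * s)" using \<epsilon> by (intro mult_left_mono) auto
    moreover have "\<epsilon> * (M * M - 2 * M * \<gamma>) \<le> \<epsilon> * ((M - \<gamma>) * (M - \<gamma>))"
      using \<epsilon> by (intro mult_left_mono) (auto simp: algebra_simps)
    ultimately show ?thesis using s(1) \<gamma>eq by (simp add: algebra_simps)
  qed
  obtain g where g: "g \<in> Dual sY" "norm g \<le> 1" "blinfun_apply g y = of_real s"
    using nd unfolding norming_dual_def s_def by blast
  \<comment> \<open>\<open>g\<close> norms \<open>y = S x\<close>, so \<open>S + R\<close> sends
    \<open>x\<close> to \<open>(1 + \<epsilon> * s) y\<close>, whose norm exceeds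
    \<open>M + \<epsilon> * M * c\<close> by \<open>key\<close>.\<close>
  define R where "R = rank_one sY (\<epsilon> *\<^sub>R (g o\<^sub>L S)) y"
  have fD: "\<epsilon> *\<^sub>R (g o\<^sub>L S) \<in> Dual sX"
    using g(1) S I unfolding rank_one_stable_def by (intro scaleR_in_Dual compose_in_Dual) auto
  have gS: "norm (g o\<^sub>L S) \<le> M"
    using order_trans[OF norm_blinfun_compose[of g S] mult_right_mono[OF g(2), of "norm S"]] unfolding M_def by simp
  have nf: "norm (\<epsilon> *\<^sub>R (g o\<^sub>L S)) \<le> \<epsilon> * M" using gS \<epsilon> by (simp add: mult_left_mono)
  define S' where "S' = S + R"
  have "S' \<in> I" using S fD I unfolding S'_def R_def rank_one_stable_def by blast
  moreover have "norm (S' - S) \<le> \<kappa>"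
  proof -
    have "norm R \<le> norm (\<epsilon> *\<^sub>R (g o\<^sub>L S)) * norm y" unfolding R_def by (rule norm_rank_one_le[OF kY])
    also have "\<dots> \<le> (\<epsilon> * M) * M" using nf s eM unfolding s_def by (intro mult_mono) auto
    finally show ?thesis using \<epsilon> unfolding S'_def by simp
  qed
  moreover have S'_gt: "M + \<epsilon> * M * c < norm S'"
  proof -
    have "blinfun_apply S' x = y + sY (of_real (\<epsilon> * s)) y"
      unfolding S'_def R_def
      by (simp add: blinfun.add_left rank_one_apply[OF kY] blinfun.scaleR_left g(3) scaleR_conv_of_real flip: y_def)
    also have "\<dots> = (1 + \<epsilon> * s) *\<^sub>R y"
      by (simp only: kbanach_of_real[OF kY] scaleR_add_left scaleR_one)
    finally have "norm (blinfun_apply S' x) = (1 + \<epsilon> * s) * s"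
      using \<epsilon> s0 by (simp add: s_def)
    then show ?thesis using key norm_blinfun_unit[OF x(1), of S'] by (simp add: algebra_simps)
  qed
  \<comment> \<open>\<open>h\<close> composed with \<open>S\<close> contributes at most
    \<open>M\<close>, so the remaining \<open>\<epsilon> * M * c\<close> must come from the rank one
    term, which is at most \<open>\<epsilon> * M\<close> times \<open>norm (h y)\<close>.\<close>
  moreover have "c \<le> norm (blinfun_apply h y)"
    if h: "h \<in> Dual sY \<inter> cball 0 1" and x': "x' \<in> cball 0 1"
      and le: "M + \<epsilon> * M * c \<le> norm (blinfun_apply h (blinfun_apply S' x'))" for h x'
  proof -
    have h1: "norm h \<le> 1" and hl: "blinfun_apply h (sY a z) = a * blinfun_apply h z" for a z
      using h unfolding Dual_def by auto
    have "blinfun_apply h (blinfun_apply S' x') = blinfun_apply h (blinfun_apply S x')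
        + blinfun_apply (\<epsilon> *\<^sub>R (g o\<^sub>L S)) x' * blinfun_apply h y"
      unfolding S'_def R_def by (simp only: blinfun.add_left blinfun.add_right rank_one_apply[OF kY] hl)
    then have "norm (blinfun_apply h (blinfun_apply S' x')) \<le> norm (blinfun_apply h (blinfun_apply S x'))
        + norm (blinfun_apply (\<epsilon> *\<^sub>R (g o\<^sub>L S)) x') * norm (blinfun_apply h y)"
      by (simp only: norm_triangle_ineq norm_mult[symmetric])
    also have "norm (blinfun_apply h (blinfun_apply S x')) \<le> 1 * M"
      using order_trans[OF norm_blinfun mult_mono[OF h1 norm_blinfun_unit[OF x', of S]]] unfolding M_def by simp
    also have "norm (blinfun_apply (\<epsilon> *\<^sub>R (g o\<^sub>L S)) x') * norm (blinfun_apply h y)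
        \<le> \<epsilon> * M * norm (blinfun_apply h y)"
      using norm_blinfun_unit[OF x', of "\<epsilon> *\<^sub>R (g o\<^sub>L S)"] nf by (intro mult_right_mono) auto
    finally have "\<epsilon> * M * c \<le> \<epsilon> * M * norm (blinfun_apply h y)" using le by simp
    then show ?thesis using eM by (simp add: mult_le_cancel_left)
  qed
  moreover have "0 \<le> M + \<epsilon> * M * c" using eM M c by simp
  \<comment> \<open>Raising the threshold to \<open>norm S' - \<kappa>\<close> brings it within
    \<open>\<kappa>\<close> of the norm and only shrinks the new slice.\<close>
  ultimately show thesis
    using that[of S' x "max (M + \<epsilon> * M * c) (norm S' - \<kappa>)"] x(1) \<kappa> s(3)
    unfolding s_def y_def by (auto simp: le_max_iff_disj)
qed

text \<open>Refinements of sizes \<open>\<kappa> / 2 ^ (n + 1)\<close> converge to an operator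
  within \<open>\<kappa>\<close> of \<open>T\<close>. An extreme point \<open>e\<close> common to
  all the slices satisfies \<open>c n \<le> norm (e (S n (x n)))\<close>, and \<open>c n\<close>
  approaches the norm of the limit, so the adjoint attains its norm at \<open>e\<close>.\<close>

lemma adjoint_attains_norm_at_extreme_point:
  fixes sX :: "'k \<Rightarrow> 'x::banach \<Rightarrow> 'x" and sY :: "'k \<Rightarrow> 'y::banach \<Rightarrow> 'y"
  assumes kY: "kbanach sY" and nd: "norming_dual sY"
    and I: "rank_one_stable sX sY I"
    and "closed I" and T: "T \<in> I" "T \<noteq> 0" and \<kappa>: "0 < \<kappa>"
  obtains S e where "S \<in> I" "norm (S - T) \<le> \<kappa>" "e extreme_point_of (Dual sY \<inter> cball 0 1)"
    "\<forall>c < norm S. \<exists>x \<in> cball 0 1. c < norm (blinfun_apply e (blinfun_apply S x))"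
proof -
  \<comment> \<open>The gap bound is waived at stage 0, where the iteration starts from
    \<open>(T, 0)\<close> with gap \<open>norm T\<close>.\<close>
  define P where "P = (\<lambda>n::nat. \<lambda>(S :: 'x \<Rightarrow>\<^sub>L 'y, c). S \<in> I \<and> 0 \<le> c \<and> c < norm S \<and>
      (n > 0 \<longrightarrow> norm S - c \<le> \<kappa> * (1/2) ^ n))"
  \<comment> \<open>\<open>x\<close> is chosen with each transition, and the implication says that
    the next slice is contained in the current one, whichever point \<open>x'\<close> the next stage
    picks.\<close>
  define Q where "Q = (\<lambda>n::nat. \<lambda>(S :: 'x \<Rightarrow>\<^sub>L 'y, c) (S', c'). norm (S' - S) \<le> \<kappa> * (1/2) ^ Suc n \<and>
      (\<exists>x \<in> cball 0 1. c \<le> norm (blinfun_apply S x) \<and>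
        (\<forall>h \<in> Dual sY \<inter> cball 0 1. \<forall>x' \<in> cball 0 1. c' \<le> norm (blinfun_apply h (blinfun_apply S' x'))
          \<longrightarrow> c \<le> norm (blinfun_apply h (blinfun_apply S x)))))"
  have "\<exists>f. \<forall>n. P n (f n) \<and> Q n (f n) (f (Suc n)) \<and> (n = 0 \<longrightarrow> f n = (T, 0))"
  proof -
    have "\<exists>f. (\<forall>n. (P n (f n) \<and> (n = 0 \<longrightarrow> f n = (T, 0))) \<and> Q n (f n) (f (Suc n)))"
    proof (rule dependent_nat_choice)
      show "\<exists>p. P 0 p \<and> (0 = (0::nat) \<longrightarrow> p = (T, 0))" using T unfolding P_def by auto
    next
      fix p n assume p: "P n p \<and> (n = 0 \<longrightarrow> p = (T, 0))"
      obtain S c where Sc: "p = (S, c)" by (cases p)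
      have S: "S \<in> I" "0 \<le> c" "c < norm S" using p Sc unfolding P_def by auto
      have pos: "0 < \<kappa> * (1/2) ^ Suc n" using \<kappa> by simp
      obtain S' c' x where "S' \<in> I" "x \<in> cball 0 1" "norm (S' - S) \<le> \<kappa> * (1/2) ^ Suc n" "0 \<le> c'" "c' < norm S'"
        "norm S' - c' \<le> \<kappa> * (1/2) ^ Suc n" "c \<le> norm (blinfun_apply S x)"
        "\<forall>h \<in> Dual sY \<inter> cball 0 1. \<forall>x' \<in> cball 0 1. c' \<le> norm (blinfun_apply h (blinfun_apply S' x'))
          \<longrightarrow> c \<le> norm (blinfun_apply h (blinfun_apply S x))"
        by (rule slice_refinement[OF kY nd I S pos]) (rule that; blast)
      then have "P (Suc n) (S', c') \<and> Q n p (S', c')" unfolding P_def Q_def Sc prod.case by blast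
      then show "\<exists>q. (P (Suc n) q \<and> (Suc n = 0 \<longrightarrow> q = (T, 0))) \<and> Q n p q" by blast
    qed
    then show ?thesis by blast
  qed
  then obtain f where f: "\<And>n. P n (f n)" "\<And>n. Q n (f n) (f (Suc n))" "f 0 = (T, 0)" by blast
  define S where "S n = fst (f n)" for n
  define c where "c n = snd (f n)" for n
  have fn: "f n = (S n, c n)" for n unfolding S_def c_def by simp
  have SI: "S n \<in> I" and c0: "0 \<le> c n" and cS: "c n < norm (S n)"
    and cS': "n > 0 \<Longrightarrow> norm (S n) - c n \<le> \<kappa> * (1/2) ^ n" for n
    using f(1)[of n] unfolding P_def fn by auto
  have S0: "S 0 = T" using f(3) unfolding S_def by simp
  have step: "norm (S (Suc n) - S n) \<le> \<kappa> * (1/2) ^ Suc n" for n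
    using f(2)[of n] unfolding Q_def fn by auto
  define D where "D n x \<longleftrightarrow> x \<in> cball 0 1 \<and> c n \<le> norm (blinfun_apply (S n) x) \<and>
        (\<forall>h \<in> Dual sY \<inter> cball 0 1. \<forall>x' \<in> cball 0 1. c (Suc n) \<le> norm (blinfun_apply h (blinfun_apply (S (Suc n)) x'))
          \<longrightarrow> c n \<le> norm (blinfun_apply h (blinfun_apply (S n) x)))" for n x
  have "\<forall>n. \<exists>x. D n x" using f(2) unfolding Q_def fn D_def prod.case by blast
  from choice[OF this] obtain x where D: "\<And>n. D n (x n)" by blast
  have x: "x n \<in> cball 0 1" "c n \<le> norm (blinfun_apply (S n) (x n))" for n
    using D[of n] unfolding D_def by blast+
  have geo: "(\<lambda>n. \<kappa> * (1/2) ^ Suc n) sums \<kappa>"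
    using sums_mult[OF power_half_series, of \<kappa>] by simp
  have ns: "summable (\<lambda>n. norm (S (Suc n) - S n))"
    by (rule summable_comparison_test'[OF sums_summable[OF geo], where N = 0]) (use step in simp)
  then have sm: "summable (\<lambda>n. S (Suc n) - S n)" by (rule summable_norm_cancel)
  define U where "U = T + (\<Sum>n. S (Suc n) - S n)"
  have lim: "S \<longlonglongrightarrow> U"
  proof -
    have "(\<lambda>n. \<Sum>i<n. S (Suc i) - S i) \<longlonglongrightarrow> (\<Sum>n. S (Suc n) - S n)" using sm by (rule summable_LIMSEQ)
    then have "(\<lambda>n. S n - T) \<longlonglongrightarrow> (\<Sum>n. S (Suc n) - S n)"
      by (simp add: sum_lessThan_telescope S0)
    from tendsto_add[OF tendsto_const[of T] this] show ?thesis unfolding U_def by simp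
  qed
  have inI: "U \<in> I" using \<open>closed I\<close> SI lim closed_sequentially by blast
  have "norm (U - T) \<le> (\<Sum>n. norm (S (Suc n) - S n))" using summable_norm[OF ns] unfolding U_def by simp
  also have "\<dots> \<le> (\<Sum>n. \<kappa> * (1/2) ^ Suc n)" by (rule suminf_le[OF step ns sums_summable[OF geo]])
  finally have dist: "norm (U - T) \<le> \<kappa>" using sums_unique[OF geo] by simp
  have "\<exists>e. e extreme_point_of (Dual sY \<inter> cball 0 1) \<and>
      (\<forall>n. c n \<le> norm (blinfun_apply e (blinfun_apply (S n) (x n))))"
  proof (rule nested_slices_extreme_point[OF kY])
    fix n
    obtain g where g: "g \<in> Dual sY" "norm g \<le> 1"
      "blinfun_apply g (blinfun_apply (S n) (x n)) = of_real (norm (blinfun_apply (S n) (x n)))"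
      using nd unfolding norming_dual_def by blast
    then show "\<exists>g\<in>Dual sY \<inter> cball 0 1. c n \<le> norm (blinfun_apply g (blinfun_apply (S n) (x n)))"
      using x(2)[of n] by (intro bexI[of _ g]) auto
  next
    fix n h
    assume "h \<in> Dual sY \<inter> cball 0 1"
      "c (Suc n) \<le> norm (blinfun_apply h (blinfun_apply (S (Suc n)) (x (Suc n))))"
    then show "c n \<le> norm (blinfun_apply h (blinfun_apply (S n) (x n)))"
      using D[of n] x(1)[of "Suc n"] unfolding D_def by blast
  qed
  then obtain e where e: "e extreme_point_of (Dual sY \<inter> cball 0 1)"
    "\<And>n. c n \<le> norm (blinfun_apply e (blinfun_apply (S n) (x n)))" by blast
  have e1: "norm e \<le> 1" using e(1) unfolding extreme_point_of_def by simp
  have "\<exists>z \<in> cball 0 1. d < norm (blinfun_apply e (blinfun_apply U z))" if d: "d < norm U" for d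
  proof -
    \<comment> \<open>For \<open>n > 0\<close> this quantity bounds
      \<open>norm (e (U (x n)))\<close> from below: \<open>c n\<close> is within
      \<open>\<kappa> * (1/2) ^ n\<close> of \<open>norm (S n)\<close>, and replacing
      \<open>S n\<close> by \<open>U\<close> costs at most \<open>norm (U - S n)\<close>.\<close>
    have "(\<lambda>n. norm (S n) - \<kappa> * (1/2) ^ n - norm (U - S n)) \<longlonglongrightarrow> norm U - \<kappa> * 0 - norm (U - U)"
      by (intro tendsto_intros lim LIMSEQ_realpow_zero) auto
    then have "(\<lambda>n. norm (S n) - \<kappa> * (1/2) ^ n - norm (U - S n)) \<longlonglongrightarrow> norm U" by simp
    from order_tendstoD(1)[OF this d]
    have "\<forall>\<^sub>F n in sequentially. d < norm (S n) - \<kappa> * (1/2) ^ n - norm (U - S n) \<and> n > 0"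
      by (intro eventually_conj eventually_gt_at_top)
    then obtain n where n: "n > 0" "d < norm (S n) - \<kappa> * (1/2) ^ n - norm (U - S n)"
      unfolding eventually_sequentially by blast
    have "norm (blinfun_apply e (blinfun_apply (U - S n) (x n))) \<le> 1 * norm (U - S n)"
      using order_trans[OF norm_blinfun mult_mono[OF e1 norm_blinfun_unit[OF x(1), of "U - S n"]]] by simp
    moreover have "blinfun_apply e (blinfun_apply (S n) (x n)) = blinfun_apply e (blinfun_apply U (x n))
        - blinfun_apply e (blinfun_apply (U - S n) (x n))"
      by (simp add: blinfun.diff_left blinfun.diff_right)
    ultimately have "c n \<le> norm (blinfun_apply e (blinfun_apply U (x n))) + norm (U - S n)"
      using e(2)[of n] norm_triangle_ineq4 by (smt (verit, best))
    then show ?thesis using n cS'[OF n(1)] x(1)[of n] by force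
  qed
  then show thesis using that inI dist e(1) by blast
qed
end

section \<open>Absolutely strongly exposing operators\<close>

context real_part
begin

text \<open>Rotations preserve the ball and turn moduli of \<open>f\<close> into real parts, so the
  supremum in \<open>SE\<close> is \<open>norm f\<close>.\<close>

lemma SE_attains_norm:
  fixes sX :: "'k \<Rightarrow> 'x::banach \<Rightarrow> 'x"
  assumes k: "kbanach sX" and f: "f \<in> SE re sX"
  obtains x0 where "x0 \<in> cball 0 1" "re (blinfun_apply f x0) = norm f"
    "\<And>xs. (\<And>n. xs n \<in> cball 0 1) \<Longrightarrow> (\<lambda>n. re (blinfun_apply f (xs n))) \<longlonglongrightarrow> norm f \<Longrightarrow> xs \<longlonglongrightarrow> x0"
proof -
  obtain x0 where x0: "x0 \<in> cball 0 1"
    "re (blinfun_apply f x0) = (SUP x \<in> cball 0 1. re (blinfun_apply f x))"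
    "\<And>xs. (\<forall>n. xs n \<in> cball 0 1) \<and> (\<lambda>n. re (blinfun_apply f (xs n))) \<longlonglongrightarrow> re (blinfun_apply f x0)
            \<Longrightarrow> xs \<longlonglongrightarrow> x0"
    using f unfolding SE_def by blast
  have fD: "blinfun_apply f (sX a x) = a * blinfun_apply f x" for a x
    using f unfolding SE_def Dual_def by blast
  have le: "re (blinfun_apply f x) \<le> norm f" if "x \<in> cball 0 1" for x
    using re_le_norm norm_blinfun_unit[OF that, of f] order_trans by blast
  have bdd: "bdd_above ((\<lambda>x. re (blinfun_apply f x)) ` cball 0 1)"
    by (rule bdd_aboveI2[OF le])
  have up: "re (blinfun_apply f x) \<le> re (blinfun_apply f x0)" if "x \<in> cball 0 1" for x
    unfolding x0(2) by (rule cSUP_upper[OF that bdd])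
  have "norm f \<le> re (blinfun_apply f x0)"
  proof (rule norm_blinfun_unit_bound)
    have "re (blinfun_apply f 0) = 0" using linear_re by (simp add: linear_0)
    then show "0 \<le> re (blinfun_apply f x0)" using up[of 0] by simp
    fix x :: 'x assume x: "x \<in> cball 0 1"
    obtain t where t: "norm t = 1" "t * blinfun_apply f x = of_real (norm (blinfun_apply f x))"
      using rotate by blast
    have "sX t x \<in> cball 0 1" using x t(1) by (simp add: kbanach_norm[OF k])
    from up[OF this] show "norm (blinfun_apply f x) \<le> re (blinfun_apply f x0)"
      by (simp add: fD t(2) re_of_real)
  qed
  then have eq: "re (blinfun_apply f x0) = norm f" using le[OF x0(1)] by simp
  show thesis
  proof (rule that[OF x0(1) eq])
    fix xs assume "\<And>n. xs n \<in> cball 0 1" "(\<lambda>n. re (blinfun_apply f (xs n))) \<longlonglongrightarrow> norm f"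
    then show "xs \<longlonglongrightarrow> x0" using x0(3)[of xs] eq by simp
  qed
qed

text \<open>Maximizing sequences for \<open>S\<close> eventually exceed \<open>D\<close> and hence are maximizing for \<open>f\<close>.\<close>

lemma ASE_if_comparable_to_SE:
  fixes sX :: "'k \<Rightarrow> 'x::banach \<Rightarrow> 'x" and sY :: "'k \<Rightarrow> 'y::banach \<Rightarrow> 'y"
  assumes k: "kbanach sX" and S: "S \<in> Lop sX sY" and f: "f \<in> SE re sX" and b: "0 < b"
    and D: "D < norm S"
    and lower: "\<And>x. b * norm (blinfun_apply f x) \<le> norm (blinfun_apply S x)"
    and upper: "\<And>x. x \<in> cball 0 1 \<Longrightarrow> norm (blinfun_apply S x) \<le> max D (b * norm (blinfun_apply f x))"
  shows "S \<in> ASE sX sY"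
proof -
  obtain x0 where x0: "x0 \<in> cball 0 1" "re (blinfun_apply f x0) = norm f"
    "\<And>xs. (\<And>n. xs n \<in> cball 0 1) \<Longrightarrow> (\<lambda>n. re (blinfun_apply f (xs n))) \<longlonglongrightarrow> norm f \<Longrightarrow> xs \<longlonglongrightarrow> x0"
    using SE_attains_norm[OF k f] by blast
  have fD: "blinfun_apply f (sX a x) = a * blinfun_apply f x" for a x
    using f unfolding SE_def Dual_def by blast
  have bf: "b * norm f \<le> norm S"
  proof -
    have "norm f \<le> norm S / b"
    proof (rule norm_blinfun_unit_bound)
      fix x :: 'x assume "x \<in> cball 0 1"
      then have "b * norm (blinfun_apply f x) \<le> norm S"
        using lower[of x] norm_blinfun_unit[of x S] by linarith
      then show "norm (blinfun_apply f x) \<le> norm S / b"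
        using b by (simp add: pos_le_divide_eq mult.commute)
    qed (use b in simp)
    then show ?thesis using b by (simp add: pos_le_divide_eq mult.commute)
  qed
  have "\<exists>\<theta>. (\<forall>n. norm (\<theta> n) = 1) \<and> (\<lambda>n. sX (\<theta> n) (xs n)) \<longlonglongrightarrow> x0"
    if ball: "\<forall>n. xs n \<in> cball 0 1" and lim: "(\<lambda>n. norm (blinfun_apply S (xs n))) \<longlonglongrightarrow> norm S" for xs
  proof -
    have "\<forall>\<^sub>F n in sequentially. D < norm (blinfun_apply S (xs n))"
      by (rule order_tendstoD(1)[OF lim D])
    then have ev: "\<forall>\<^sub>F n in sequentially. norm (blinfun_apply S (xs n)) / b = norm (blinfun_apply f (xs n))"
    proof (rule eventually_mono)
      fix n assume "D < norm (blinfun_apply S (xs n))"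
      then have "norm (blinfun_apply S (xs n)) = b * norm (blinfun_apply f (xs n))"
        using upper[of "xs n"] lower[of "xs n"] ball by (auto simp: max_def split: if_splits)
      then show "norm (blinfun_apply S (xs n)) / b = norm (blinfun_apply f (xs n))" using b by simp
    qed
    have limf: "(\<lambda>n. norm (blinfun_apply f (xs n))) \<longlonglongrightarrow> norm S / b"
      by (rule Lim_transform_eventually[OF tendsto_divide[OF lim tendsto_const] ev]) (use b in simp)
    \<comment> \<open>Each \<open>norm (f (xs n))\<close> is at most \<open>norm f\<close>, so the
      limit is too; with \<open>bf\<close> the limit equals \<open>norm f\<close>.\<close>
    have "norm S / b \<le> norm f"
      by (rule tendsto_upperbound[OF limf]) (use ball in \<open>simp_all add: norm_blinfun_unit\<close>)
    moreover have "norm f \<le> norm S / b" using bf b by (simp add: pos_le_divide_eq mult.commute)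
    ultimately have eq: "norm S / b = norm f" by (rule antisym)
    \<comment> \<open>These rotations make \<open>f (xs n)\<close> real and nonnegative, so the
      rotated sequence maximizes the real part of \<open>f\<close> and strong exposure
      applies.\<close>
    have "\<forall>n. \<exists>t. norm t = 1 \<and> t * blinfun_apply f (xs n) = of_real (norm (blinfun_apply f (xs n)))"
      using rotate by blast
    from choice[OF this] obtain \<theta> where \<theta>: "\<And>n. norm (\<theta> n) = 1"
      "\<And>n. \<theta> n * blinfun_apply f (xs n) = of_real (norm (blinfun_apply f (xs n)))" by blast
    have "(\<lambda>n. sX (\<theta> n) (xs n)) \<longlonglongrightarrow> x0"
    proof (rule x0(3))
      show "sX (\<theta> n) (xs n) \<in> cball 0 1" for n
        using ball \<theta>(1) by (simp add: kbanach_norm[OF k])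
      show "(\<lambda>n. re (blinfun_apply f (sX (\<theta> n) (xs n)))) \<longlonglongrightarrow> norm f"
        using limf by (simp add: fD \<theta>(2) re_of_real eq)
    qed
    then show ?thesis using \<theta>(1) by blast
  qed
  then show ?thesis using S x0(1) unfolding ASE_def by blast
qed

text \<open>With \<open>f = (1 + \<eta>) p - g \<circ> S\<close> and \<open>g y = 1\<close>,
  composing the new operator with \<open>g\<close> yields \<open>(1 + \<eta>) p\<close>. Since
  \<open>norm (h y) \<le> r\<close> for the other \<open>h\<close> in \<open>A\<close>, these gain
  at most the fraction \<open>r\<close> of the bound on \<open>norm f\<close> and stay at or below
  \<open>D\<close>, which the choice of \<open>\<delta>\<close> keeps under
  \<open>(1 + \<eta>) * norm p\<close>.\<close>

lemma ASE_perturbation: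
  fixes sX :: "'k \<Rightarrow> 'x::banach \<Rightarrow> 'x" and sY :: "'k \<Rightarrow> 'y::banach \<Rightarrow> 'y"
  assumes kX: "kbanach sX" and kY: "kbanach sY" and dense: "Dual sX \<subseteq> closure (SE re sX)"
    and S: "S \<in> Lop sX sY" "S \<noteq> 0"
    and A: "A \<subseteq> Dual sY \<inter> cball 0 1"
    and norming: "\<forall>z. \<forall>c < norm z. \<exists>h \<in> A. c < norm (blinfun_apply h z)"
    and g: "g \<in> A" and y: "norm y = 1" "blinfun_apply g y = 1"
    and r: "0 \<le> r" "r < 1" "\<forall>h \<in> A. h \<noteq> g \<longrightarrow> norm (blinfun_apply h y) \<le> r"
    and \<eta>: "0 < \<eta>" "\<eta> \<le> 1"
    and almost: "norm S - \<eta> * norm S * (1 - r) / 8 < norm (g o\<^sub>L S)"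
  obtains f where "f \<in> Dual sX" "norm f \<le> 3 * \<eta> * norm S" "S + rank_one sY f y \<in> ASE sX sY"
proof -
  define M where "M = norm S"
  have M: "0 < M" using S(2) unfolding M_def by simp
  \<comment> \<open>The losses below add up to at most \<open>6 * \<delta>\<close>, while the room
    available is \<open>\<eta> * M * (1 - r) = 8 * \<delta>\<close>.\<close>
  define \<delta> where "\<delta> = \<eta> * M * (1 - r) / 8"
  have \<delta>: "0 < \<delta>" using \<eta> M r unfolding \<delta>_def by simp
  have gD: "g \<in> Dual sY" "norm g \<le> 1" using g A by auto
  let ?gS = "g o\<^sub>L S"
  have gSM: "norm ?gS \<le> M"
    using order_trans[OF norm_blinfun_compose[of g S] mult_right_mono[OF gD(2), of "norm S"]]
    unfolding M_def by simp
  have gS_ge: "M - \<delta> < norm ?gS" using almost unfolding M_def \<delta>_def .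
  have "?gS \<in> closure (SE re sX)" using compose_in_Dual[OF gD(1) S(1)] dense by blast
  then obtain p where p: "p \<in> SE re sX" "dist p ?gS < \<delta>" using \<delta> by (meson closure_approachable)
  have pD: "p \<in> Dual sX" using p(1) unfolding SE_def by blast
  have pg: "norm (p - ?gS) < \<delta>" using p(2) by (simp add: dist_norm)
  have np: "M - 2 * \<delta> < norm p" "norm p < M + \<delta>"
    using norm_triangle_ineq3[of p ?gS] pg gS_ge gSM by linarith+
  define f where "f = (1 + \<eta>) *\<^sub>R p - ?gS"
  have fD: "f \<in> Dual sX"
    unfolding f_def using pD compose_in_Dual[OF gD(1) S(1)] by (intro diff_in_Dual scaleR_in_Dual)
  have nf: "norm f \<le> \<delta> + \<eta> * (M + \<delta>)"
  proof -
    have "f = (p - ?gS) + \<eta> *\<^sub>R p" unfolding f_def by (simp add: algebra_simps)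
    then have "norm f \<le> norm (p - ?gS) + norm (\<eta> *\<^sub>R p)" by (simp only: norm_triangle_ineq)
    also have "norm (\<eta> *\<^sub>R p) \<le> \<eta> * (M + \<delta>)" using np \<eta> by simp
    finally show ?thesis using pg by simp
  qed
  define R where "R = S + rank_one sY f y"
  have RL: "R \<in> Lop sX sY" unfolding R_def by (intro add_in_Lop[OF kY] S(1) rank_one_in_Lop[OF kY fD])
  have app: "blinfun_apply h (blinfun_apply R x)
      = blinfun_apply h (blinfun_apply S x) + blinfun_apply f x * blinfun_apply h y" if "h \<in> Dual sY" for h x
    using that unfolding R_def Dual_def
    by (simp add: blinfun.add_left blinfun.add_right rank_one_apply[OF kY])
  have gR: "norm (blinfun_apply g (blinfun_apply R x)) = (1 + \<eta>) * norm (blinfun_apply p x)" for x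
  proof -
    have "blinfun_apply g (blinfun_apply R x) = (1 + \<eta>) *\<^sub>R blinfun_apply p x"
      unfolding app[OF gD(1)] y(2) f_def by (simp add: blinfun.diff_left blinfun.scaleR_left)
    then show ?thesis using \<eta> by simp
  qed
  define D where "D = M + (\<delta> + \<eta> * (M + \<delta>)) * r"
  have lower: "(1 + \<eta>) * norm (blinfun_apply p x) \<le> norm (blinfun_apply R x)" for x
    using order_trans[OF norm_blinfun mult_right_mono[OF gD(2)], of "blinfun_apply R x"]
    by (simp flip: gR)
  have "D < (1 + \<eta>) * norm p"
  proof -
    have "(1 + \<eta>) * (M - 2 * \<delta>) \<le> (1 + \<eta>) * norm p" using np \<eta> by (intro mult_left_mono) auto
    moreover have "D < (1 + \<eta>) * (M - 2 * \<delta>)"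
    proof -
      have "\<delta> * r \<le> \<delta>" "\<delta> * \<eta> \<le> \<delta>" "\<delta> * (\<eta> * r) \<le> \<delta>"
        using r \<delta> \<eta> by (simp_all add: mult_le_one)
      moreover have "8 * \<delta> = \<eta> * M * (1 - r)" unfolding \<delta>_def by simp
      moreover have "(1 + \<eta>) * (M - 2 * \<delta>) - D =
          \<eta> * M * (1 - r) - (\<delta> * r + \<delta> * (\<eta> * r) + 2 * \<delta> + 2 * (\<delta> * \<eta>))"
        unfolding D_def by (simp add: algebra_simps)
      ultimately show ?thesis using \<delta> by linarith
    qed
    ultimately show ?thesis by linarith
  qed
  moreover have "(1 + \<eta>) * norm p \<le> norm R"
  proof -
    have "norm p \<le> norm R / (1 + \<eta>)"
    proof (rule norm_blinfun_unit_bound)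
      fix x :: 'x assume "x \<in> cball 0 1"
      then have "(1 + \<eta>) * norm (blinfun_apply p x) \<le> norm R"
        using lower[of x] norm_blinfun_unit[of x R] by linarith
      then show "norm (blinfun_apply p x) \<le> norm R / (1 + \<eta>)"
        using \<eta> by (simp add: pos_le_divide_eq mult.commute)
    qed (use \<eta> in simp)
    then show ?thesis using \<eta> by (simp add: pos_le_divide_eq mult.commute)
  qed
  ultimately have DR: "D < norm R" by linarith
  have upper: "norm (blinfun_apply R x) \<le> max D ((1 + \<eta>) * norm (blinfun_apply p x))"
    if x: "x \<in> cball 0 1" for x
  proof (rule ccontr)
    assume "\<not> ?thesis"
    then obtain h where h: "h \<in> A" "max D ((1 + \<eta>) * norm (blinfun_apply p x)) < norm (blinfun_apply h (blinfun_apply R x))"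
      using norming not_le by blast
    then have hg: "h \<noteq> g" using gR[of x] by auto
    have hD: "h \<in> Dual sY" "norm h \<le> 1" using h(1) A by auto
    have "norm (blinfun_apply h (blinfun_apply R x))
        \<le> norm (blinfun_apply h (blinfun_apply S x)) + norm (blinfun_apply f x) * norm (blinfun_apply h y)"
      unfolding app[OF hD(1)] by (simp only: norm_triangle_ineq norm_mult[symmetric])
    also have "norm (blinfun_apply h (blinfun_apply S x)) \<le> 1 * M"
      using order_trans[OF norm_blinfun mult_mono[OF hD(2) norm_blinfun_unit[OF x, of S]]]
      unfolding M_def by simp
    also have "norm (blinfun_apply f x) * norm (blinfun_apply h y) \<le> (\<delta> + \<eta> * (M + \<delta>)) * r"
      using norm_blinfun_unit[OF x, of f] nf r(3)[rule_format, OF h(1) hg] r(1) norm_ge_zero[of f]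
        norm_ge_zero[of "blinfun_apply h y"]
      by (intro mult_mono) linarith+
    finally have "norm (blinfun_apply h (blinfun_apply R x)) \<le> D" unfolding D_def by simp
    then show False using h(2) by simp
  qed
  have "R \<in> ASE sX sY"
    by (rule ASE_if_comparable_to_SE[OF kX RL p(1) _ DR lower upper]) (use \<eta> in simp)
  moreover have "norm f \<le> 3 * \<eta> * norm S"
  proof -
    have "\<delta> \<le> \<eta> * M / 8" unfolding \<delta>_def using \<eta> M r by (intro divide_right_mono mult_left_le) auto
    moreover have "\<eta> * \<delta> \<le> \<delta>" using \<eta> \<delta> by simp
    moreover have "0 < \<eta> * M" using \<eta> M by simp
    ultimately have "\<delta> + \<eta> * (M + \<delta>) \<le> 3 * (\<eta> * M)" by (simp add: algebra_simps)
    then show ?thesis using nf unfolding M_def by simp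
  qed
  ultimately show thesis using that fD unfolding R_def by blast
qed

text \<open>An operator \<open>S\<close> near \<open>T\<close> whose adjoint attains its norm at
  \<open>e\<close> is perturbed once more, at a functional \<open>g\<close> of \<open>Ae\<close>.
  The bound on \<open>\<rho>\<close> is uniform on that set, so the required closeness of
  \<open>norm (g \<circ> S)\<close> to \<open>norm S\<close> is fixed before \<open>g\<close> is
  chosen.\<close>

lemma ASE_dense_nonzero:
  fixes sX :: "'k \<Rightarrow> 'x::banach \<Rightarrow> 'x" and sY :: "'k \<Rightarrow> 'y::banach \<Rightarrow> 'y"
  assumes kX: "kbanach sX" and kY: "kbanach sY" and nd: "norming_dual sY"
    and dense: "Dual sX \<subseteq> closure (SE re sX)" and qb: "quasi_beta sY"
    and I: "rank_one_stable sX sY I" and cl: "closed I" and T: "T \<in> I" "T \<noteq> 0" and \<kappa>: "0 < \<kappa>"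
  shows "\<exists>S \<in> ASE sX sY \<inter> I. norm (S - T) < \<kappa>"
proof -
  obtain A :: "('y \<Rightarrow>\<^sub>L 'k) set" and \<sigma> \<rho> where
    A: "A \<subseteq> Dual sY \<inter> sphere 0 1" and \<sigma>: "\<forall>g \<in> A. \<sigma> g \<in> sphere 0 1"
    and \<sigma>1: "\<forall>g \<in> A. blinfun_apply g (\<sigma> g) = 1"
    and \<rho>: "\<forall>g \<in> A. \<forall>h \<in> A. g \<noteq> h \<longrightarrow> norm (blinfun_apply h (\<sigma> g)) \<le> \<rho> g \<and> \<rho> g < 1"
    and ext: "\<forall>e. e extreme_point_of (Dual sY \<inter> cball 0 1) \<longrightarrow>
        (\<exists>Ae \<subseteq> A. \<exists>t::'k. norm t = 1 \<and> (\<lambda>y. t * blinfun_apply e y) \<in> closure (blinfun_apply ` Ae) \<and>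
           (\<exists>r < 1. \<forall>g \<in> Ae. \<rho> g \<le> r))"
    using qb unfolding quasi_beta_def by (elim exE conjE) (rule that)
  have A': "A \<subseteq> Dual sY \<inter> cball 0 1" using A by auto
  \<comment> \<open>Extreme points of the dual ball norm \<open>'y\<close>, and rotations of them
    lie in the weak-star closure of \<open>A\<close>, so \<open>A\<close> is norming.\<close>
  have norming: "\<forall>z. \<forall>c < norm z. \<exists>h \<in> A. c < norm (blinfun_apply h z)"
  proof (intro allI impI)
    fix z :: 'y and c assume c: "c < norm z"
    obtain e where e: "e extreme_point_of (Dual sY \<inter> cball 0 1)" "norm z \<le> norm (blinfun_apply e z)"
      by (rule norming_extreme_point[OF kY nd])
    obtain Ae t where Ae: "Ae \<subseteq> A" "norm t = 1" "(\<lambda>y. t * blinfun_apply e y) \<in> closure (blinfun_apply ` Ae)"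
      using ext e(1) by blast
    have "c < norm (blinfun_apply e z)" using c e(2) by linarith
    then obtain g where "g \<in> Ae" "c < norm (blinfun_apply g z)"
      by (rule norm_approx_in_closure[OF Ae(3,2)])
    then show "\<exists>h \<in> A. c < norm (blinfun_apply h z)" using Ae(1) by blast
  qed
  have nT: "0 < norm T" using T by simp
  \<comment> \<open>The second bound keeps \<open>S\<close> away from 0; the first leaves most of
    \<open>\<kappa>\<close> for the rank one term.\<close>
  define \<mu> where "\<mu> = min (\<kappa> / 4) (norm T / 2)"
  have \<mu>: "0 < \<mu>" "\<mu> \<le> \<kappa> / 4" "\<mu> \<le> norm T / 2" using \<kappa> nT unfolding \<mu>_def by auto
  obtain S e where S: "S \<in> I" "norm (S - T) \<le> \<mu>" and e: "e extreme_point_of (Dual sY \<inter> cball 0 1)"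
    and attain: "\<forall>c < norm S. \<exists>x \<in> cball 0 1. c < norm (blinfun_apply e (blinfun_apply S x))"
    by (rule adjoint_attains_norm_at_extreme_point[OF kY nd I cl T \<mu>(1)])
  have S0: "0 < norm S" using S(2) \<mu>(3) nT norm_triangle_ineq3[of S T] by linarith
  have SL: "S \<in> Lop sX sY" using S(1) I unfolding rank_one_stable_def by blast
  obtain Ae t r0 where Ae: "Ae \<subseteq> A" "norm t = 1" "(\<lambda>y. t * blinfun_apply e y) \<in> closure (blinfun_apply ` Ae)"
    and r0: "r0 < 1" "\<forall>g \<in> Ae. \<rho> g \<le> r0"
    using ext[rule_format, OF e] by (elim exE conjE) (rule that)
  \<comment> \<open>\<open>r0\<close> may be negative, while \<open>ASE_perturbation\<close> asks
    for \<open>0 \<le> r\<close>.\<close>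
  define r where "r = max 0 r0"
  have r: "0 \<le> r" "r < 1" "r0 \<le> r" using r0(1) unfolding r_def by auto
  \<comment> \<open>The rank one term then has norm at most \<open>\<kappa> / 2\<close>, for a total
    of at most \<open>3 * \<kappa> / 4\<close>.\<close>
  define \<eta> where "\<eta> = min 1 (\<kappa> / (6 * norm S))"
  have \<eta>: "0 < \<eta>" "\<eta> \<le> 1" "3 * \<eta> * norm S \<le> \<kappa> / 2"
  proof -
    have "\<eta> * norm S \<le> \<kappa> / (6 * norm S) * norm S"
      unfolding \<eta>_def using S0 by (intro mult_right_mono) auto
    then show "3 * \<eta> * norm S \<le> \<kappa> / 2" using S0 by simp
  qed (use \<kappa> S0 in \<open>auto simp: \<eta>_def\<close>)
  have "0 < \<eta> * norm S * (1 - r) / 8" using \<eta> S0 r by simp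
  then have "norm S - \<eta> * norm S * (1 - r) / 8 < norm S" by linarith
  then obtain x where x: "x \<in> cball 0 1"
    "norm S - \<eta> * norm S * (1 - r) / 8 < norm (blinfun_apply e (blinfun_apply S x))"
    using attain by blast
  obtain g where g: "g \<in> Ae" "norm S - \<eta> * norm S * (1 - r) / 8 < norm (blinfun_apply g (blinfun_apply S x))"
    by (rule norm_approx_in_closure[OF Ae(3,2) x(2)])
  have gA: "g \<in> A" using g(1) Ae(1) by blast
  have almost: "norm S - \<eta> * norm S * (1 - r) / 8 < norm (g o\<^sub>L S)"
    using g(2) norm_blinfun_unit[OF x(1), of "g o\<^sub>L S"] by simp
  have gr: "\<forall>h \<in> A. h \<noteq> g \<longrightarrow> norm (blinfun_apply h (\<sigma> g)) \<le> r"
  proof (intro ballI impI)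
    fix h assume h: "h \<in> A" "h \<noteq> g"
    have "norm (blinfun_apply h (\<sigma> g)) \<le> \<rho> g"
      using \<rho>[rule_format, OF gA h(1) h(2)[symmetric]] by simp
    then show "norm (blinfun_apply h (\<sigma> g)) \<le> r" using r0(2)[rule_format, OF g(1)] r(3) by linarith
  qed
  have \<sigma>n: "norm (\<sigma> g) = 1" using \<sigma> gA by simp
  have Sne: "S \<noteq> 0" using S0 by auto
  obtain f where f: "f \<in> Dual sX" "norm f \<le> 3 * \<eta> * norm S" "S + rank_one sY f (\<sigma> g) \<in> ASE sX sY"
    by (rule ASE_perturbation[OF kX kY dense SL Sne A' norming gA \<sigma>n \<sigma>1[rule_format, OF gA] r(1,2) gr \<eta>(1,2) almost])
  have "S + rank_one sY f (\<sigma> g) \<in> I" using I S(1) f(1) unfolding rank_one_stable_def by blast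
  moreover have "norm (S + rank_one sY f (\<sigma> g) - T) < \<kappa>"
  proof -
    have "norm (S + rank_one sY f (\<sigma> g) - T) \<le> norm (S - T) + norm (rank_one sY f (\<sigma> g))"
      using norm_triangle_ineq[of "S - T" "rank_one sY f (\<sigma> g)"] by (simp add: algebra_simps)
    moreover have "norm (rank_one sY f (\<sigma> g)) \<le> norm f"
      using norm_rank_one_le[OF kY, of f "\<sigma> g"] \<sigma>n by simp
    ultimately show ?thesis using S(2) \<mu>(2) f(2) \<eta>(3) \<kappa> by linarith
  qed
  ultimately show ?thesis using f(3) by blast
qed

text \<open>The iteration needs a nonzero start, so approximation of 0 is separate:
  \<open>p \<otimes> y\<close> with \<open>y\<close> a unit vector has pointwise the modulus of
  \<open>p\<close>, and \<open>SE\<close> contains arbitrarily small \<open>p\<close>.\<close>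

lemma ASE_near_zero:
  fixes sX :: "'k \<Rightarrow> 'x::banach \<Rightarrow> 'x" and sY :: "'k \<Rightarrow> 'y::banach \<Rightarrow> 'y" and y :: 'y
  assumes kX: "kbanach sX" and kY: "kbanach sY"
    and dense: "Dual sX \<subseteq> closure (SE re sX)" and y: "norm y = 1"
    and I: "rank_one_stable sX sY I" and \<kappa>: "0 < \<kappa>"
  shows "\<exists>S \<in> ASE sX sY \<inter> I. norm S < \<kappa>"
proof -
  have "0 \<in> closure (SE re sX)" using dense unfolding Dual_def by auto
  then obtain p where p: "p \<in> SE re sX" "norm p < \<kappa>"
    using \<kappa> closure_approachable[of 0 "SE re sX"] by auto
  have pD: "p \<in> Dual sX" using p(1) unfolding SE_def by blast
  have n: "norm (blinfun_apply (rank_one sY p y) x) = norm (blinfun_apply p x)" for x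
    by (simp add: rank_one_apply[OF kY] kbanach_norm[OF kY] y)
  have "rank_one sY p y \<in> ASE sX sY"
    \<comment> \<open>The threshold \<open>D = - 1\<close> is below every norm, so with
      \<open>b = 1\<close> both comparisons hold as equalities.\<close>
    by (rule ASE_if_comparable_to_SE[OF kX rank_one_in_Lop[OF kY pD] p(1), of 1 "- 1"])
      (simp_all add: n less_le_trans[OF _ norm_ge_zero])
  moreover have "norm (rank_one sY p y) < \<kappa>" using norm_rank_one_le[OF kY, of p y] y p(2) by simp
  moreover have "rank_one sY p y \<in> I" using I pD unfolding rank_one_stable_def by blast
  ultimately show ?thesis by blast
qed

text \<open>The dual ball has an extreme point, a multiple of which lies in the closure of a subset
  of \<open>A\<close>; so \<open>A\<close> is nonempty and \<open>\<sigma>\<close> supplies the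
  vector.\<close>

lemma quasi_beta_unit_vector:
  fixes sY :: "'k \<Rightarrow> 'y::banach \<Rightarrow> 'y"
  assumes kY: "kbanach sY" and nd: "norming_dual sY" and qb: "quasi_beta sY"
  obtains y :: 'y where "norm y = 1"
proof -
  obtain A :: "('y \<Rightarrow>\<^sub>L 'k) set" and \<sigma> :: "('y \<Rightarrow>\<^sub>L 'k) \<Rightarrow> 'y" where
    \<sigma>: "\<forall>g \<in> A. \<sigma> g \<in> sphere 0 1"
    and ext: "\<forall>e. e extreme_point_of (Dual sY \<inter> cball 0 1) \<longrightarrow>
        (\<exists>Ae \<subseteq> A. \<exists>t::'k. (\<lambda>y. t * blinfun_apply e y) \<in> closure (blinfun_apply ` Ae))"
    using qb unfolding quasi_beta_def by metis
  obtain e where "e extreme_point_of (Dual sY \<inter> cball 0 1)"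
    by (rule norming_extreme_point[OF kY nd])
  then obtain Ae t where Ae: "Ae \<subseteq> A" "(\<lambda>y. t * blinfun_apply e y) \<in> closure (blinfun_apply ` Ae)"
    using ext by blast
  then obtain g where "g \<in> A" by fastforce
  then show thesis using \<sigma> that by force
qed

theorem ASE_dense:
  fixes sX :: "'k \<Rightarrow> 'x::banach \<Rightarrow> 'x" and sY :: "'k \<Rightarrow> 'y::banach \<Rightarrow> 'y"
  assumes kX: "kbanach sX" and kY: "kbanach sY" and nd: "norming_dual sY"
    and dense: "Dual sX \<subseteq> closure (SE re sX)" and qb: "quasi_beta sY"
    and I: "rank_one_stable sX sY I" and cl: "closed I"
  shows "I \<subseteq> closure (ASE sX sY \<inter> I)"
proof
  fix T assume T: "T \<in> I"
  obtain y :: 'y where y: "norm y = 1" using quasi_beta_unit_vector[OF kY nd qb] by blast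
  show "T \<in> closure (ASE sX sY \<inter> I)"
    unfolding closure_approachable dist_norm
  proof (intro allI impI)
    fix \<kappa> :: real assume \<kappa>: "0 < \<kappa>"
    show "\<exists>S\<in>ASE sX sY \<inter> I. norm (S - T) < \<kappa>"
    proof (cases "T = 0")
      case True
      then show ?thesis using ASE_near_zero[OF kX kY dense y I \<kappa>] by simp
    next
      case False
      then show ?thesis using ASE_dense_nonzero[OF kX kY nd dense qb I cl T _ \<kappa>] by simp
    qed
  qed
qed

end

section \<open>Closed subspaces of operators\<close>

lemma rank_one_stable_if_closed_subspace_rank1:
  assumes kY: "kbanach sY" and I: "closed_subspace_rank1 sX sY I"
  shows "rank_one_stable sX sY I"
proof -
  have "rank_one sY f y \<in> I" if f: "f \<in> Dual sX" for f y
  proof -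
    have "rank_one sY f y \<in> Lop sX sY" by (rule rank_one_in_Lop[OF kY f])
    moreover have "\<exists>f \<in> Dual sX. \<exists>y'. \<forall>x. blinfun_apply (rank_one sY f' y) x = sY (blinfun_apply f x) y'"
      if "f' = f" for f'
      using f that rank_one_apply[OF kY] by blast
    ultimately show ?thesis using I unfolding closed_subspace_rank1_def by blast
  qed
  then show ?thesis using I unfolding rank_one_stable_def closed_subspace_rank1_def by blast
qed

lemma closed_Lop:
  assumes kY: "kbanach sY"
  shows "closed (Lop sX sY)"
proof -
  have bl: "bounded_linear (sY a)" for a
    by (rule bounded_linear_intro[where K = "norm a"])
      (simp_all add: kbanach_add_right[OF kY] kbanach_scaleR_right[OF kY] kbanach_norm[OF kY] mult.commute)
  have "continuous_on UNIV (\<lambda>T. blinfun_apply T x)" for x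
    by (intro continuous_intros)
  then show ?thesis
    unfolding Lop_def
    by (intro closed_Collect_all closed_Collect_eq bounded_linear.continuous_on[OF bl])
qed

lemma rank_one_stable_Lop:
  assumes "kbanach sY"
  shows "rank_one_stable sX sY (Lop sX sY)"
  unfolding rank_one_stable_def using add_in_Lop[OF assms] rank_one_in_Lop[OF assms] by blast

section \<open>Compact operators described by finite nets\<close>

lemma compact_closure_image_iff:
  fixes T :: "'x::banach \<Rightarrow>\<^sub>L 'y::banach"
  shows "compact (closure (blinfun_apply T ` cball 0 1)) \<longleftrightarrow>
    (\<forall>e>0. \<exists>k. finite k \<and> (\<forall>x \<in> cball 0 1. \<exists>z \<in> k. norm (blinfun_apply T x - z) < e))"
    (is "compact (closure ?B) \<longleftrightarrow> ?R")
proof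
  assume c: "compact (closure ?B)"
  show ?R
  proof (intro allI impI)
    fix e :: real assume "0 < e"
    then obtain k where "finite k" "closure ?B \<subseteq> (\<Union>z\<in>k. ball z e)"
      using c unfolding compact_eq_totally_bounded by blast
    moreover have "\<exists>z \<in> k. norm (blinfun_apply T x - z) < e" if "x \<in> cball 0 1" for x
    proof -
      have "blinfun_apply T x \<in> closure ?B" by (rule subsetD[OF closure_subset imageI[OF that]])
      then obtain z where "z \<in> k" "blinfun_apply T x \<in> ball z e"
        using \<open>closure ?B \<subseteq> (\<Union>z\<in>k. ball z e)\<close> by blast
      then show ?thesis by (intro bexI[of _ z]) (simp_all add: dist_norm norm_minus_commute)
    qed
    ultimately show "\<exists>k. finite k \<and> (\<forall>x \<in> cball 0 1. \<exists>z \<in> k. norm (blinfun_apply T x - z) < e)"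
      by blast
  qed
next
  assume R: ?R
  show "compact (closure ?B)"
    unfolding compact_eq_totally_bounded
  proof (intro conjI allI impI)
    show "complete (closure ?B)" by (simp add: complete_eq_closed)
    fix e :: real assume "0 < e"
    then obtain k where k: "finite k" "\<forall>x \<in> cball 0 1. \<exists>z \<in> k. norm (blinfun_apply T x - z) < e / 2"
      using R[rule_format, of "e / 2"] by auto
    \<comment> \<open>Closed balls of half the radius have a closed finite union, which absorbs the
      closure and still fits into the open balls of radius \<open>e\<close>.\<close>
    have "?B \<subseteq> (\<Union>z\<in>k. cball z (e / 2))"
    proof (rule image_subsetI)
      fix x :: 'x assume "x \<in> cball 0 1"
      then obtain z where "z \<in> k" "norm (blinfun_apply T x - z) < e / 2" using k(2) by blast
      then show "blinfun_apply T x \<in> (\<Union>z\<in>k. cball z (e / 2))"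
        by (intro UN_I[of z]) (simp_all add: dist_norm norm_minus_commute)
    qed
    moreover have "closed (\<Union>z\<in>k. cball z (e / 2))" using k(1) by (intro closed_UN) auto
    ultimately have "closure ?B \<subseteq> (\<Union>z\<in>k. cball z (e / 2))" by (rule closure_minimal)
    also have "\<dots> \<subseteq> (\<Union>z\<in>k. ball z e)"
      using \<open>0 < e\<close> by (intro UN_mono order_refl) auto
    finally show "\<exists>k. finite k \<and> closure ?B \<subseteq> (\<Union>z\<in>k. ball z e)" using k(1) by blast
  qed
qed

lemma Kop_iff:
  "T \<in> Kop sX sY \<longleftrightarrow> T \<in> Lop sX sY \<and>
    (\<forall>e>0. \<exists>k. finite k \<and> (\<forall>x \<in> cball 0 1. \<exists>z \<in> k. norm (blinfun_apply T x - z) < e))"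
  by (simp only: Kop_def mem_Collect_eq compact_closure_image_iff)

lemma Kop_finite_net:
  assumes "T \<in> Kop sX sY" "0 < e"
  obtains k where "finite k" "\<forall>x \<in> cball 0 1. \<exists>z \<in> k. norm (blinfun_apply T x - z) < e / 2"
  using assms half_gt_zero unfolding Kop_iff by metis

text \<open>A finite net of radius \<open>e / 2\<close> for some \<open>S n\<close> within
  \<open>e / 2\<close> of \<open>T\<close> is a net of radius \<open>e\<close> for
  \<open>T\<close>.\<close>

lemma closed_Kop:
  assumes kY: "kbanach sY"
  shows "closed (Kop sX sY)"
  unfolding closed_sequential_limits
proof (intro allI impI, elim conjE)
  fix S T assume S: "\<forall>n. S n \<in> Kop sX sY" and lim: "S \<longlonglongrightarrow> T"
  have "T \<in> Lop sX sY"
    using closed_sequentially[OF closed_Lop[OF kY] _ lim] S unfolding Kop_def by blast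
  moreover have "\<exists>k. finite k \<and> (\<forall>x \<in> cball 0 1. \<exists>z \<in> k. norm (blinfun_apply T x - z) < e)"
    if e: "0 < e" for e
  proof -
    obtain n where n: "norm (S n - T) < e / 2"
      using LIMSEQ_D[OF lim half_gt_zero[OF e]] by blast
    obtain k where k: "finite k" "\<forall>x \<in> cball 0 1. \<exists>z \<in> k. norm (blinfun_apply (S n) x - z) < e / 2"
      by (rule Kop_finite_net[OF S[rule_format, of n] e])
    have "\<exists>z \<in> k. norm (blinfun_apply T x - z) < e" if x: "x \<in> cball 0 1" for x
    proof -
      obtain z where z: "z \<in> k" "norm (blinfun_apply (S n) x - z) < e / 2" using k(2) x by blast
      have "blinfun_apply T x - z = (blinfun_apply (S n) x - z) - blinfun_apply (S n - T) x"
        by (simp add: blinfun.diff_left)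
      then have "norm (blinfun_apply T x - z) \<le> norm (blinfun_apply (S n) x - z) + norm (blinfun_apply (S n - T) x)"
        by (simp only: norm_triangle_ineq4)
      then have "norm (blinfun_apply T x - z) < e"
        using z(2) n norm_blinfun_unit[OF x, of "S n - T"] by linarith
      then show ?thesis using z(1) by blast
    qed
    then show ?thesis using k(1) by blast
  qed
  ultimately show "T \<in> Kop sX sY" unfolding Kop_iff by blast
qed

lemma rank_one_stable_Kop:
  fixes sX :: "'k::{real_normed_field,heine_borel} \<Rightarrow> 'x::banach \<Rightarrow> 'x" and sY :: "'k \<Rightarrow> 'y::banach \<Rightarrow> 'y"
  assumes kY: "kbanach sY"
  shows "rank_one_stable sX sY (Kop sX sY)"
  unfolding rank_one_stable_def
proof (intro conjI ballI allI)
  show "Kop sX sY \<subseteq> Lop sX sY" unfolding Kop_def by blast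
next
  fix S T assume S: "S \<in> Kop sX sY" and T: "T \<in> Kop sX sY"
  have "\<exists>k. finite k \<and> (\<forall>x \<in> cball 0 1. \<exists>z \<in> k. norm (blinfun_apply (S + T) x - z) < e)"
    if e: "0 < e" for e
  proof -
    obtain k where k: "finite k" "\<forall>x \<in> cball 0 1. \<exists>z \<in> k. norm (blinfun_apply S x - z) < e / 2"
      by (rule Kop_finite_net[OF S e])
    obtain l where l: "finite l" "\<forall>x \<in> cball 0 1. \<exists>z \<in> l. norm (blinfun_apply T x - z) < e / 2"
      by (rule Kop_finite_net[OF T e])
    \<comment> \<open>Pairwise sums of centres: the two errors below \<open>e / 2\<close> add up to
      less than \<open>e\<close>.\<close>
    let ?m = "(\<lambda>(a, b). a + b) ` (k \<times> l)"
    have "\<exists>z \<in> ?m. norm (blinfun_apply (S + T) x - z) < e" if x: "x \<in> cball 0 1" for x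
    proof -
      obtain a where a: "a \<in> k" "norm (blinfun_apply S x - a) < e / 2" using k(2) x by blast
      obtain b where b: "b \<in> l" "norm (blinfun_apply T x - b) < e / 2" using l(2) x by blast
      have "blinfun_apply (S + T) x - (a + b) = (blinfun_apply S x - a) + (blinfun_apply T x - b)"
        by (simp add: blinfun.add_left)
      then have "norm (blinfun_apply (S + T) x - (a + b)) \<le> norm (blinfun_apply S x - a) + norm (blinfun_apply T x - b)"
        by (simp only: norm_triangle_ineq)
      then have "norm (blinfun_apply (S + T) x - (a + b)) < e" using a(2) b(2) by linarith
      moreover have "a + b \<in> ?m" using a(1) b(1) by force
      ultimately show ?thesis by blast
    qed
    moreover have "finite ?m" using k(1) l(1) by blast
    ultimately show ?thesis by blast
  qed
  then show "S + T \<in> Kop sX sY"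
    using S T add_in_Lop[OF kY, of S sX T] unfolding Kop_iff by blast
next
  fix f y assume f: "f \<in> Dual sX"
  have bl: "bounded_linear (\<lambda>a. sY a y)"
    by (rule bounded_linear_intro[where K = "norm y"])
      (simp_all add: kbanach_add_left[OF kY] kbanach_scaleR_left[OF kY] kbanach_norm[OF kY])
  \<comment> \<open>A rank one operator maps the ball into a continuous image of a closed scalar
    ball, which is compact.\<close>
  let ?C = "(\<lambda>a. sY a y) ` cball 0 (norm f)"
  have C: "compact ?C"
    by (intro compact_continuous_image bounded_linear.continuous_on[OF bl] continuous_on_id compact_cball)
  have "blinfun_apply (rank_one sY f y) ` cball 0 1 \<subseteq> ?C"
  proof (rule image_subsetI)
    fix x :: 'x assume "x \<in> cball 0 1"
    then have "blinfun_apply f x \<in> cball 0 (norm f)" using norm_blinfun_unit by simp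
    then show "blinfun_apply (rank_one sY f y) x \<in> ?C" unfolding rank_one_apply[OF kY] by (rule imageI)
  qed
  then have "closure (blinfun_apply (rank_one sY f y) ` cball 0 1) \<subseteq> ?C"
    by (rule closure_minimal[OF _ compact_imp_closed[OF C]])
  then have "compact (closure (blinfun_apply (rank_one sY f y) ` cball 0 1))"
    using compact_Int_closed[OF C closed_closure] by (metis inf.absorb2)
  then show "rank_one sY f y \<in> Kop sX sY" using rank_one_in_Lop[OF kY f] unfolding Kop_def by blast
qed

lemma (in real_part) ASE_dense_in_ideals:
  fixes sX :: "'k \<Rightarrow> 'x::banach \<Rightarrow> 'x" and sY :: "'k \<Rightarrow> 'y::banach \<Rightarrow> 'y"
  assumes kX: "kbanach sX" and kY: "kbanach sY" and nd: "norming_dual sY"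
    and dense: "Dual sX \<subseteq> closure (SE re sX)" and qb: "quasi_beta sY"
  shows "(\<forall>I. closed_subspace_rank1 sX sY I \<longrightarrow> I \<subseteq> closure (ASE sX sY \<inter> I))
        \<and> Lop sX sY \<subseteq> closure (ASE sX sY \<inter> Lop sX sY)
        \<and> Kop sX sY \<subseteq> closure (ASE sX sY \<inter> Kop sX sY)"
proof (intro conjI allI impI)
  fix I assume I: "closed_subspace_rank1 sX sY I"
  moreover have "closed I" using I unfolding closed_subspace_rank1_def by blast
  ultimately show "I \<subseteq> closure (ASE sX sY \<inter> I)"
    by (intro ASE_dense[OF assms] rank_one_stable_if_closed_subspace_rank1[OF kY])
next
  show "Lop sX sY \<subseteq> closure (ASE sX sY \<inter> Lop sX sY)"
    by (rule ASE_dense[OF assms rank_one_stable_Lop[OF kY] closed_Lop[OF kY]])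
next
  show "Kop sX sY \<subseteq> closure (ASE sX sY \<inter> Kop sX sY)"
    by (rule ASE_dense[OF assms rank_one_stable_Kop[OF kY] closed_Kop[OF kY]])
qed

section \<open>The real and complex instances\<close>

lemma real_part_real: "real_part (\<lambda>r::real. r)"
proof
  show "\<exists>t. norm t = 1 \<and> t * a = of_real (norm a)" for a :: real
    by (rule exI[of _ "if a < 0 then - 1 else 1"]) simp
qed (simp_all add: linear_id[unfolded id_def])

lemma real_part_complex: "real_part Re"
proof
  show "\<exists>t. norm t = 1 \<and> t * a = of_real (norm a)" for a :: complex
  proof (cases "a = 0")
    case False
    then show ?thesis by (intro exI[of _ "of_real (norm a) / a"]) (simp add: norm_divide)
  qed (auto intro: exI[of _ 1])
qed (simp_all add: complex_Re_le_cmod bounded_linear.linear[OF bounded_linear_Re])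

lemma kbanach_scaleR: "kbanach (scaleR :: real \<Rightarrow> 'x::banach \<Rightarrow> 'x)"
  unfolding kbanach_def by (simp add: algebra_simps)

theorem theorem3p1:
  shows
   "(Dual (scaleR :: real \<Rightarrow> 'a::banach \<Rightarrow> 'a) \<subseteq> closure (SE (\<lambda>r. r) scaleR)
      \<and> quasi_beta (scaleR :: real \<Rightarrow> 'b::banach \<Rightarrow> 'b)
      \<longrightarrow> (\<forall>I. closed_subspace_rank1 (scaleR :: real \<Rightarrow> 'a \<Rightarrow> 'a) (scaleR :: real \<Rightarrow> 'b \<Rightarrow> 'b) I
              \<longrightarrow> I \<subseteq> closure (ASE scaleR scaleR \<inter> I))
        \<and> Lop (scaleR :: real \<Rightarrow> 'a \<Rightarrow> 'a) (scaleR :: real \<Rightarrow> 'b \<Rightarrow> 'b)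
            \<subseteq> closure (ASE scaleR scaleR \<inter> Lop scaleR scaleR)
        \<and> Kop (scaleR :: real \<Rightarrow> 'a \<Rightarrow> 'a) (scaleR :: real \<Rightarrow> 'b \<Rightarrow> 'b)
            \<subseteq> closure (ASE scaleR scaleR \<inter> Kop scaleR scaleR))
    \<and>
    (\<forall>(sX :: complex \<Rightarrow> 'c::banach \<Rightarrow> 'c) (sY :: complex \<Rightarrow> 'd::banach \<Rightarrow> 'd).
      kbanach sX \<and> kbanach sY \<and>
      Dual sX \<subseteq> closure (SE Re sX) \<and> quasi_beta sY
      \<longrightarrow> (\<forall>I. closed_subspace_rank1 sX sY I \<longrightarrow> I \<subseteq> closure (ASE sX sY \<inter> I))
        \<and> Lop sX sY \<subseteq> closure (ASE sX sY \<inter> Lop sX sY)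
        \<and> Kop sX sY \<subseteq> closure (ASE sX sY \<inter> Kop sX sY))"
proof (rule conjI; (intro allI)?; rule impI; elim conjE)
  assume "Dual (scaleR :: real \<Rightarrow> 'a \<Rightarrow> 'a) \<subseteq> closure (SE (\<lambda>r. r) scaleR)"
    "quasi_beta (scaleR :: real \<Rightarrow> 'b \<Rightarrow> 'b)"
  then show "(\<forall>I. closed_subspace_rank1 (scaleR :: real \<Rightarrow> 'a \<Rightarrow> 'a) (scaleR :: real \<Rightarrow> 'b \<Rightarrow> 'b) I
              \<longrightarrow> I \<subseteq> closure (ASE scaleR scaleR \<inter> I))
        \<and> Lop (scaleR :: real \<Rightarrow> 'a \<Rightarrow> 'a) (scaleR :: real \<Rightarrow> 'b \<Rightarrow> 'b)
            \<subseteq> closure (ASE scaleR scaleR \<inter> Lop scaleR scaleR)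
        \<and> Kop (scaleR :: real \<Rightarrow> 'a \<Rightarrow> 'a) (scaleR :: real \<Rightarrow> 'b \<Rightarrow> 'b)
            \<subseteq> closure (ASE scaleR scaleR \<inter> Kop scaleR scaleR)"
    by (rule real_part.ASE_dense_in_ideals[OF real_part_real kbanach_scaleR kbanach_scaleR norming_dual_real])
next
  fix sX :: "complex \<Rightarrow> 'c \<Rightarrow> 'c" and sY :: "complex \<Rightarrow> 'd \<Rightarrow> 'd"
  assume k: "kbanach sX" "kbanach sY" and "Dual sX \<subseteq> closure (SE Re sX)" "quasi_beta sY"
  then show "(\<forall>I. closed_subspace_rank1 sX sY I \<longrightarrow> I \<subseteq> closure (ASE sX sY \<inter> I))
        \<and> Lop sX sY \<subseteq> closure (ASE sX sY \<inter> Lop sX sY)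
        \<and> Kop sX sY \<subseteq> closure (ASE sX sY \<inter> Kop sX sY)"
    by (intro real_part.ASE_dense_in_ideals[OF real_part_complex k norming_dual_complex[OF k(2)]])
qed

end
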